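(* Let $\mathcal I$ be a layered ideal on a set $I$, and let $M_i$ ($i\in I$) be structures in a common countable language such that the theory of $M=\prod_i M_i/\mathcal I$ is stable. Then $M$ is $\mathfrak c$-saturated. In particular, if $|M_i|\leq\mathfrak c$ for every $i$, then $M$ is saturated.
   Context: An ideal $\mathcal I$ on $I$ is layered if $I$ is the union of countably many sets in $\mathcal I$ and there is $\mu\colon\mathcal P(I)\to[0,\infty]$ such that $A\subseteq B$ implies $\mu(A)\le\mu(B)$, $\mathcal I=\{A:\mu(A)<\infty\}$, and $A\notin\mathcal I$ iff $\sup\{\mu(B):B\subseteq A,B\in\mathcal I\}=\infty$. Reduced product: $\prod_iM_i$ modulo $(a_i)\sim(b_i)\iff\{i:a_i\ne b_i\}\in\mathcal I$, functions coordinatewise, relations holding iff they fail on a set in $\mathcal I$. $\mathfrak c=2^{\aleph_0}$. $\kappa$-saturated: every consistent set of formulas in one free variable with parameters from a set of size $<\kappa$ is realised; saturated: $|M|$-saturated. A complete theory is stable if no formula $\varphi(\bar x,\bar y)$ has the order property (for every $k$ there are $\bar a_i,\bar b_i$, $i<k$, in a model with $\varphi(\bar a_i,\bar b_j)$ iff $i\le j$).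
   Formalization: The second claim (M is saturated if all |M_i| ≤ 𝔠) is stated under the extra hypothesis 2^|I| ≤ 𝔠 (automatic for countable I); without a bound on I it is false, since M may have more than 𝔠 elements while a definable infinite set has only 𝔠. *)

theory Defs
  imports
    Complex_Main
    "HOL-Library.FuncSet"
    "HOL-Library.Countable_Set"
    "HOL-Library.Equipollence"
    "HOL-Library.Extended_Nonnegative_Real"
begin

subsection \<open>First-order logic\<close>

text \<open>Constants are function symbols of arity 0; equality is a logical symbol.\<close>

record ('f, 'r) language =
  funs :: "'f set"
  fun_arity :: "'f \<Rightarrow> nat"
  rels :: "'r set"
  rel_arity :: "'r \<Rightarrow> nat"

definition countable_language :: "('f, 'r) language \<Rightarrow> bool" where
  "countable_language L \<longleftrightarrow> countable (funs L) \<and> countable (rels L)"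

datatype 'f tm = Var nat | App 'f "'f tm list"

datatype ('f, 'r) fm =
    Eql "'f tm" "'f tm"
  | Rel 'r "'f tm list"
  | Neg "('f, 'r) fm"
  | Conj "('f, 'r) fm" "('f, 'r) fm"
  | Exists nat "('f, 'r) fm"

fun wf_tm :: "('f, 'r) language \<Rightarrow> 'f tm \<Rightarrow> bool" where
  "wf_tm L (Var n) \<longleftrightarrow> True"
| "wf_tm L (App f ts) \<longleftrightarrow> f \<in> funs L \<and> length ts = fun_arity L f \<and> (\<forall>t\<in>set ts. wf_tm L t)"

fun wf_fm :: "('f, 'r) language \<Rightarrow> ('f, 'r) fm \<Rightarrow> bool" where
  "wf_fm L (Eql s t) \<longleftrightarrow> wf_tm L s \<and> wf_tm L t"
| "wf_fm L (Rel r ts) \<longleftrightarrow> r \<in> rels L \<and> length ts = rel_arity L r \<and> (\<forall>t\<in>set ts. wf_tm L t)"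
| "wf_fm L (Neg p) \<longleftrightarrow> wf_fm L p"
| "wf_fm L (Conj p q) \<longleftrightarrow> wf_fm L p \<and> wf_fm L q"
| "wf_fm L (Exists n p) \<longleftrightarrow> wf_fm L p"

fun fv_tm :: "'f tm \<Rightarrow> nat set" where
  "fv_tm (Var n) = {n}"
| "fv_tm (App f ts) = (\<Union>t\<in>set ts. fv_tm t)"

fun fv :: "('f, 'r) fm \<Rightarrow> nat set" where
  "fv (Eql s t) = fv_tm s \<union> fv_tm t"
| "fv (Rel r ts) = (\<Union>t\<in>set ts. fv_tm t)"
| "fv (Neg p) = fv p"
| "fv (Conj p q) = fv p \<union> fv q"
| "fv (Exists n p) = fv p - {n}"

record ('f, 'r, 'a) struct =
  universe :: "'a set"
  fun_interp :: "'f \<Rightarrow> 'a list \<Rightarrow> 'a"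
  rel_interp :: "'r \<Rightarrow> 'a list \<Rightarrow> bool"

definition is_structure :: "('f, 'r) language \<Rightarrow> ('f, 'r, 'a) struct \<Rightarrow> bool" where
  "is_structure L M \<longleftrightarrow> universe M \<noteq> {} \<and>
    (\<forall>f\<in>funs L. \<forall>as\<in>lists (universe M). length as = fun_arity L f \<longrightarrow> fun_interp M f as \<in> universe M)"

fun eval_tm :: "('f, 'r, 'a) struct \<Rightarrow> (nat \<Rightarrow> 'a) \<Rightarrow> 'f tm \<Rightarrow> 'a" where
  "eval_tm M e (Var n) = e n"
| "eval_tm M e (App f ts) = fun_interp M f (map (eval_tm M e) ts)"

fun sat :: "('f, 'r, 'a) struct \<Rightarrow> (nat \<Rightarrow> 'a) \<Rightarrow> ('f, 'r) fm \<Rightarrow> bool" where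
  "sat M e (Eql s t) \<longleftrightarrow> eval_tm M e s = eval_tm M e t"
| "sat M e (Rel r ts) \<longleftrightarrow> rel_interp M r (map (eval_tm M e) ts)"
| "sat M e (Neg p) \<longleftrightarrow> \<not> sat M e p"
| "sat M e (Conj p q) \<longleftrightarrow> sat M e p \<and> sat M e q"
| "sat M e (Exists n p) \<longleftrightarrow> (\<exists>a\<in>universe M. sat M (e(n := a)) p)"

definition theory_of :: "('f, 'r) language \<Rightarrow> ('f, 'r, 'a) struct \<Rightarrow> ('f, 'r) fm set" where
  "theory_of L M = {p. wf_fm L p \<and> fv p = {} \<and> (\<forall>e. range e \<subseteq> universe M \<longrightarrow> sat M e p)}"

definition is_model :: "('f, 'r) language \<Rightarrow> ('f, 'r) fm set \<Rightarrow> ('f, 'r, 'a) struct \<Rightarrow> bool" where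
  "is_model L T N \<longleftrightarrow> is_structure L N \<and> (\<forall>p\<in>T. \<forall>e. range e \<subseteq> universe N \<longrightarrow> sat N e p)"


subsection \<open>Stability\<close>

text \<open>
  A partitioned formula \<open>\<phi>(x, y)\<close> is a formula \<open>p\<close> with a set \<open>X\<close> of variables: the tuple \<open>x\<close>
  consists of the free variables of \<open>p\<close> in \<open>X\<close>, the tuple \<open>y\<close> of the remaining ones. The tuples
  \<open>a i\<close> and \<open>b j\<close> are given as assignments, read off on the respective variables only.

  HOL cannot quantify over types inside a formula, so the models range over structures
  with elements in a type \<open>'u\<close>, passed as a parameter. For a complete theory the choice is immaterial
  as long as the theory has a model in \<open>'u\<close>: for each \<open>k\<close>, the existence of the required tuples is
  expressed by a sentence, so it holds in one model iff it holds in all of them.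
\<close>

definition order_property ::
    "'u itself \<Rightarrow> ('f, 'r) language \<Rightarrow> ('f, 'r) fm set \<Rightarrow> nat set \<Rightarrow> ('f, 'r) fm \<Rightarrow> bool" where
  "order_property U L T X p \<longleftrightarrow>
    (\<forall>k. \<exists>(N :: ('f, 'r, 'u) struct) a b. is_model L T N \<and>
      (\<forall>i<k. range (a i) \<subseteq> universe N \<and> range (b i) \<subseteq> universe N) \<and>
      (\<forall>i<k. \<forall>j<k. sat N (override_on (b j) (a i) X) p \<longleftrightarrow> i \<le> (j::nat)))"

definition stable :: "'u itself \<Rightarrow> ('f, 'r) language \<Rightarrow> ('f, 'r) fm set \<Rightarrow> bool" where
  "stable U L T \<longleftrightarrow> \<not> (\<exists>X p. wf_fm L p \<and> order_property U L T X p)"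


subsection \<open>Saturation\<close>

text \<open>
  A formula in the free variable \<open>Var 0\<close> with parameters from \<open>A\<close> is a pair \<open>(p, e)\<close> where \<open>e\<close>
  assigns parameters to the other free variables of \<open>p\<close>.
\<close>

definition param_fms ::
    "('f, 'r) language \<Rightarrow> 'a set \<Rightarrow> (('f, 'r) fm \<times> (nat \<Rightarrow> 'a)) set" where
  "param_fms L A = {(p, e). wf_fm L p \<and> (\<forall>v\<in>fv p - {0}. e v \<in> A)}"

definition realises ::
    "('f, 'r, 'a) struct \<Rightarrow> 'a \<Rightarrow> (('f, 'r) fm \<times> (nat \<Rightarrow> 'a)) set \<Rightarrow> bool" where
  "realises M c P \<longleftrightarrow> c \<in> universe M \<and> (\<forall>(p, e)\<in>P. sat M (e(0 := c)) p)"

text \<open>Consistency is with respect to the theory of \<open>M\<close> with its parameters named.\<close>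

definition consistent ::
    "('f, 'r, 'a) struct \<Rightarrow> (('f, 'r) fm \<times> (nat \<Rightarrow> 'a)) set \<Rightarrow> bool" where
  "consistent M P \<longleftrightarrow> (\<forall>Q. finite Q \<and> Q \<subseteq> P \<longrightarrow> (\<exists>c. realises M c Q))"

text \<open>The cardinal \<open>\<kappa>\<close> is represented by any set \<open>K\<close> of that cardinality.\<close>

definition card_saturated ::
    "('f, 'r) language \<Rightarrow> 'k set \<Rightarrow> ('f, 'r, 'a) struct \<Rightarrow> bool" where
  "card_saturated L K M \<longleftrightarrow>
    (\<forall>A P. A \<subseteq> universe M \<and> A \<prec> K \<and> P \<subseteq> param_fms L A \<and> consistent M P \<longrightarrow> (\<exists>c. realises M c P))"

definition saturated :: "('f, 'r) language \<Rightarrow> ('f, 'r, 'a) struct \<Rightarrow> bool" where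
  "saturated L M \<longleftrightarrow> card_saturated L (universe M) M"

abbreviation continuum :: "nat set set" where
  "continuum \<equiv> UNIV"


subsection \<open>Layered ideals\<close>

definition ideal_on :: "'i set \<Rightarrow> 'i set set \<Rightarrow> bool" where
  "ideal_on I J \<longleftrightarrow> J \<subseteq> Pow I \<and> {} \<in> J \<and> (\<forall>A\<in>J. \<forall>B\<subseteq>A. B \<in> J) \<and> (\<forall>A\<in>J. \<forall>B\<in>J. A \<union> B \<in> J)"

definition layered :: "'i set \<Rightarrow> 'i set set \<Rightarrow> bool" where
  "layered I J \<longleftrightarrow> ideal_on I J \<and>
    (\<exists>C\<subseteq>J. countable C \<and> \<Union>C = I) \<and>
    (\<exists>\<mu> :: 'i set \<Rightarrow> ennreal.
      (\<forall>A B. A \<subseteq> B \<and> B \<subseteq> I \<longrightarrow> \<mu> A \<le> \<mu> B) \<and>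
      J = {A. A \<subseteq> I \<and> \<mu> A < \<infinity>} \<and>
      (\<forall>A\<subseteq>I. A \<notin> J \<longleftrightarrow> (SUP B \<in> {B. B \<subseteq> A \<and> B \<in> J}. \<mu> B) = \<infinity>))"


subsection \<open>Reduced products\<close>

definition red_rel ::
    "'i set \<Rightarrow> 'i set set \<Rightarrow> ('i \<Rightarrow> ('f, 'r, 'a) struct) \<Rightarrow> ('i \<Rightarrow> 'a) rel" where
  "red_rel I J M = {(a, b). a \<in> (\<Pi>\<^sub>E i\<in>I. universe (M i)) \<and> b \<in> (\<Pi>\<^sub>E i\<in>I. universe (M i)) \<and>
    {i \<in> I. a i \<noteq> b i} \<in> J}"

text \<open>The interpretations do not depend on the representatives picked by \<open>red_rep\<close>; see below.\<close>

definition red_rep :: "('i \<Rightarrow> 'a) set \<Rightarrow> 'i \<Rightarrow> 'a" where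
  "red_rep c = (SOME a. a \<in> c)"

definition reduced_product ::
    "'i set \<Rightarrow> 'i set set \<Rightarrow> ('i \<Rightarrow> ('f, 'r, 'a) struct) \<Rightarrow> ('f, 'r, ('i \<Rightarrow> 'a) set) struct" where
  "reduced_product I J M = \<lparr>
    universe = (\<Pi>\<^sub>E i\<in>I. universe (M i)) // red_rel I J M,
    fun_interp = (\<lambda>f cs. red_rel I J M `` {\<lambda>i\<in>I. fun_interp (M i) f (map (\<lambda>c. red_rep c i) cs)}),
    rel_interp = (\<lambda>r cs. {i \<in> I. \<not> rel_interp (M i) r (map (\<lambda>c. red_rep c i) cs)} \<in> J)\<rparr>"

lemma equiv_red_rel:
  assumes "ideal_on I J"
  shows "equiv (\<Pi>\<^sub>E i\<in>I. universe (M i)) (red_rel I J M)"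
proof (rule equivI)
  show "red_rel I J M \<subseteq> (\<Pi>\<^sub>E i\<in>I. universe (M i)) \<times> (\<Pi>\<^sub>E i\<in>I. universe (M i))"
    by (auto simp: red_rel_def)
  show "refl_on (\<Pi>\<^sub>E i\<in>I. universe (M i)) (red_rel I J M)"
    using assms by (auto simp: red_rel_def refl_on_def ideal_on_def)
  show "sym (red_rel I J M)"
    by (auto simp: red_rel_def sym_def eq_commute)
  show "trans (red_rel I J M)"
  proof (rule transI)
    fix a b c
    assume *: "(a, b) \<in> red_rel I J M" "(b, c) \<in> red_rel I J M"
    then have "{i \<in> I. a i \<noteq> b i} \<union> {i \<in> I. b i \<noteq> c i} \<in> J"
      using assms by (auto simp: red_rel_def ideal_on_def)
    moreover have "{i \<in> I. a i \<noteq> c i} \<subseteq> {i \<in> I. a i \<noteq> b i} \<union> {i \<in> I. b i \<noteq> c i}"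
      by auto
    ultimately have "{i \<in> I. a i \<noteq> c i} \<in> J"
      using assms unfolding ideal_on_def by blast
    with * show "(a, c) \<in> red_rel I J M"
      by (auto simp: red_rel_def)
  qed
qed

lemma red_rep_diff:
  assumes J: "ideal_on I J"
    and as: "as \<in> lists (\<Pi>\<^sub>E i\<in>I. universe (M i))"
  shows "{i \<in> I. map (\<lambda>c. red_rep c i) (map (\<lambda>a. red_rel I J M `` {a}) as) \<noteq> map (\<lambda>a. a i) as} \<in> J"
  using as
proof (induction as)
  case Nil
  then show ?case using J by (simp add: ideal_on_def)
next
  case (Cons a as)
  let ?c = "red_rel I J M `` {a}"
  have "a \<in> ?c"
    using Cons.hyps by (intro equiv_class_self[OF equiv_red_rel[OF J]])
  then have "red_rep ?c \<in> ?c"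
    unfolding red_rep_def by (rule someI[where P = "\<lambda>b. b \<in> red_rel I J M `` {a}"])
  moreover have "{i \<in> I. a i \<noteq> b i} \<in> J" if "b \<in> ?c" for b
    using that by (simp add: red_rel_def)
  ultimately have "{i \<in> I. a i \<noteq> red_rep ?c i} \<in> J" by blast
  with Cons.IH have "{i \<in> I. a i \<noteq> red_rep ?c i} \<union>
      {i \<in> I. map (\<lambda>c. red_rep c i) (map (\<lambda>a. red_rel I J M `` {a}) as) \<noteq> map (\<lambda>a. a i) as} \<in> J"
    using J unfolding ideal_on_def by blast
  moreover have "{i \<in> I. map (\<lambda>c. red_rep c i) (map (\<lambda>a. red_rel I J M `` {a}) (a # as))
        \<noteq> map (\<lambda>a. a i) (a # as)} \<subseteq>
      {i \<in> I. a i \<noteq> red_rep ?c i} \<union>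
      {i \<in> I. map (\<lambda>c. red_rep c i) (map (\<lambda>a. red_rel I J M `` {a}) as) \<noteq> map (\<lambda>a. a i) as}"
    by auto
  ultimately show ?case
    using J unfolding ideal_on_def by blast
qed

lemma rel_interp_reduced_product:
  assumes J: "ideal_on I J"
    and as: "as \<in> lists (\<Pi>\<^sub>E i\<in>I. universe (M i))"
  shows "rel_interp (reduced_product I J M) r (map (\<lambda>a. red_rel I J M `` {a}) as) \<longleftrightarrow>
    {i \<in> I. \<not> rel_interp (M i) r (map (\<lambda>a. a i) as)} \<in> J"
proof -
  define h where "h i = map (\<lambda>c. red_rep c i) (map (\<lambda>a. red_rel I J M `` {a}) as)" for i
  define D where "D = {i \<in> I. h i \<noteq> map (\<lambda>a. a i) as}"
  have D: "D \<in> J"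
    using red_rep_diff[OF J as] unfolding D_def h_def .
  have absorb: "A \<in> J" if "B \<in> J" "A \<subseteq> B \<union> D" for A B
    using J D that unfolding ideal_on_def by blast
  have "{i \<in> I. \<not> rel_interp (M i) r (h i)} \<in> J \<longleftrightarrow>
      {i \<in> I. \<not> rel_interp (M i) r (map (\<lambda>a. a i) as)} \<in> J"
    by (rule iffI; erule absorb) (auto simp: D_def)
  then show ?thesis
    by (simp add: reduced_product_def h_def)
qed

lemma fun_interp_reduced_product:
  assumes J: "ideal_on I J"
    and M: "\<forall>i\<in>I. is_structure L (M i)"
    and f: "f \<in> funs L" "length as = fun_arity L f"
    and as: "as \<in> lists (\<Pi>\<^sub>E i\<in>I. universe (M i))"
  shows "fun_interp (reduced_product I J M) f (map (\<lambda>a. red_rel I J M `` {a}) as) =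
    red_rel I J M `` {\<lambda>i\<in>I. fun_interp (M i) f (map (\<lambda>a. a i) as)}"
proof -
  define h where "h i = map (\<lambda>c. red_rep c i) (map (\<lambda>a. red_rel I J M `` {a}) as)" for i
  have D: "{i \<in> I. h i \<noteq> map (\<lambda>a. a i) as} \<in> J"
    using red_rep_diff[OF J as] unfolding h_def .
  have rep: "red_rep (red_rel I J M `` {a}) \<in> (\<Pi>\<^sub>E i\<in>I. universe (M i))" if "a \<in> set as" for a
  proof -
    have "a \<in> red_rel I J M `` {a}"
        using that as by (intro equiv_class_self[OF equiv_red_rel[OF J]]) auto
    then have "red_rep (red_rel I J M `` {a}) \<in> red_rel I J M `` {a}"
      unfolding red_rep_def by (rule someI[where P = "\<lambda>b. b \<in> red_rel I J M `` {a}"])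
    moreover have "b \<in> (\<Pi>\<^sub>E i\<in>I. universe (M i))" if "b \<in> red_rel I J M `` {a}" for b
      using that by (simp add: red_rel_def)
    ultimately show ?thesis by blast
  qed
  have "fun_interp (M i) f (h i) \<in> universe (M i)" if "i \<in> I" for i
  proof -
    have "h i \<in> lists (universe (M i))"
      using rep that by (force simp: h_def)
    moreover have "length (h i) = fun_arity L f"
      using f by (simp add: h_def)
    ultimately show ?thesis using M f that by (auto simp: is_structure_def)
  qed
  moreover have "fun_interp (M i) f (map (\<lambda>a. a i) as) \<in> universe (M i)" if "i \<in> I" for i
  proof -
    have "map (\<lambda>a. a i) as \<in> lists (universe (M i))"
      using as that by force
    moreover have "length (map (\<lambda>a. a i) as) = fun_arity L f"
      using f by simp
    ultimately show ?thesis using M f that unfolding is_structure_def by blast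
  qed
  moreover have "{i \<in> I. fun_interp (M i) f (h i) \<noteq> fun_interp (M i) f (map (\<lambda>a. a i) as)} \<in> J"
  proof -
    have "{i \<in> I. fun_interp (M i) f (h i) \<noteq> fun_interp (M i) f (map (\<lambda>a. a i) as)} \<subseteq>
        {i \<in> I. h i \<noteq> map (\<lambda>a. a i) as}" by auto
    then show ?thesis using J D unfolding ideal_on_def by blast
  qed
  moreover have "{i \<in> I. (\<lambda>i\<in>I. fun_interp (M i) f (h i)) i \<noteq>
        (\<lambda>i\<in>I. fun_interp (M i) f (map (\<lambda>a. a i) as)) i} =
      {i \<in> I. fun_interp (M i) f (h i) \<noteq> fun_interp (M i) f (map (\<lambda>a. a i) as)}"
    by auto
  ultimately have "(\<lambda>i\<in>I. fun_interp (M i) f (h i), \<lambda>i\<in>I. fun_interp (M i) f (map (\<lambda>a. a i) as))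
      \<in> red_rel I J M"
    unfolding red_rel_def by (simp add: restrict_PiE_iff)
  then have "red_rel I J M `` {\<lambda>i\<in>I. fun_interp (M i) f (h i)} =
      red_rel I J M `` {\<lambda>i\<in>I. fun_interp (M i) f (map (\<lambda>a. a i) as)}"
    by (rule equiv_class_eq[OF equiv_red_rel[OF J]])
  then show ?thesis
    by (simp add: reduced_product_def h_def)
qed

text \<open>
  If every factor has at most \<open>2\<^sup>\<aleph>\<^sup>0\<close> elements, then so does the reduced product, provided that \<open>I\<close>
  has at most \<open>2\<^sup>\<aleph>\<^sup>0\<close> subsets (in particular, if \<open>I\<close> is countable). Without a bound on \<open>I\<close> a
  \<open>2\<^sup>\<aleph>\<^sup>0\<close>-saturated reduced product of such factors can fail to be saturated: let \<open>K\<close> be a set with more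
  than \<open>2\<^sup>\<aleph>\<^sup>0\<close> subsets, let \<open>I = \<omega> \<times> K\<close>, and take the layered ideal of all sets contained in
  \<open>n \<times> K\<close> for some \<open>n\<close>. In the language of one unary predicate \<open>U\<close>, fix \<open>k\<^sub>0 \<in> K\<close> and let the
  factors at \<open>(n, k\<^sub>0)\<close> be \<open>{u, u', v}\<close> with \<open>U = {u, u'}\<close>, and all others \<open>{u, v}\<close> with \<open>U = {u}\<close>.
  The theory of the reduced product \<open>M\<close> is that of an infinite coinfinite predicate, hence stable.
  But \<open>U\<close> has exactly \<open>2\<^sup>\<aleph>\<^sup>0\<close> elements in \<open>M\<close>, whereas \<open>M\<close> has at least \<open>2\<^sup>|\<^sup>K\<^sup>|\<close>, so \<open>M\<close> omits
  the consistent type \<open>{U(x)} \<union> {x \<noteq> a | a. U(a)}\<close> over fewer than \<open>|M|\<close> parameters.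
\<close>

end

theory Submission imports Defs begin

text \<open>
  Call a formula \<^emph>\<open>horn\<close> if it holds in the reduced product iff it holds in almost all factors. Since
  every positive set splits into disjoint positive sets, every formula is equivalent in the product to
  a Boolean combination of horn formulas. If the theory is stable, the same splitting shows that two
  instances \<open>p(x, e)\<close>, \<open>p(x, e')\<close> of a horn formula define equal or disjoint sets. So a complete type
  is determined by countably many instances of horn formulas that it contains, together with the
  negations of all instances of the remaining ones. Layeredness allows to diagonalise along an almost
  disjoint family: there are \<open>2\<^sup>\<aleph>\<^sup>0\<close> realisations of the positive part, no two of which belong to the
  same instance of a remaining horn formula. Hence each negated instance excludes at most one of them,
  and fewer than \<open>2\<^sup>\<aleph>\<^sup>0\<close> instances leave a realisation of the type.
\<close>

section \<open>Cardinality\<close>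

lemma Pow_lepoll_mono: "A \<lesssim> B \<Longrightarrow> Pow A \<lesssim> Pow B"
  unfolding lepoll_def by (metis Pow_mono image_Pow_surj inj_on_image_Pow)

lemma countable_lepoll_infinite: "countable A \<Longrightarrow> infinite B \<Longrightarrow> A \<lesssim> B"
  by (metis countable_def infinite_le_lepoll lepoll_def lepoll_trans subset_UNIV)

lemma infinite_times_self_eqpoll: "infinite A \<Longrightarrow> A \<times> A \<approx> A"
  by (simp add: eqpoll_iff_card_of_ordIso card_of_Times_same_infinite)

lemma infinite_times_lepoll: "infinite C \<Longrightarrow> A \<lesssim> C \<Longrightarrow> B \<lesssim> C \<Longrightarrow> A \<times> B \<lesssim> C"
  by (rule lepoll_trans2[OF times_lepoll_mono infinite_times_self_eqpoll])

lemma lists_lepoll_infinite: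
  assumes "infinite A"
  shows "lists A \<lesssim> A"
proof -
  have lists_length: "{xs \<in> lists A. length xs = n} \<lesssim> A" for n
  proof (induction n)
    case 0
    have "{xs \<in> lists A. length xs = 0} = {[]}" by auto
    then show ?case
      using assms by (simp add: countable_lepoll_infinite)
  next
    case (Suc n)
    have "{xs \<in> lists A. length xs = Suc n}
        \<subseteq> (\<lambda>(x, xs). x # xs) ` (A \<times> {xs \<in> lists A. length xs = n})"
      by (force simp: length_Suc_conv)
    then have "{xs \<in> lists A. length xs = Suc n} \<lesssim> A \<times> {xs \<in> lists A. length xs = n}"
      by (rule subset_image_lepoll)
    also have "\<dots> \<lesssim> A"
      using assms Suc by (intro infinite_times_lepoll) auto
    finally show ?case .
  qed
  have "lists A = (\<Union>n. {xs \<in> lists A. length xs = n})" by auto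
  also have "\<dots> \<lesssim> (SIGMA n:(UNIV :: nat set). {xs \<in> lists A. length xs = n})"
    by (rule subset_image_lepoll[of _ snd]) force
  also have "\<dots> \<lesssim> (UNIV :: nat set) \<times> A"
    using lists_length by (intro Sigma_lepoll_mono) auto
  also have "\<dots> \<lesssim> A"
    using assms by (simp add: infinite_times_lepoll infinite_le_lepoll)
  finally show ?thesis .
qed

lemma nat_lesspoll_continuum: "(UNIV :: nat set) \<prec> continuum"
  using lesspoll_Pow_self[of "UNIV :: nat set"] by simp

lemma countable_times_lists_lesspoll:
  assumes "countable F" "(UNIV :: nat set) \<prec> K" "A \<prec> K"
  shows "F \<times> lists A \<prec> K"
proof (cases "finite A")
  case True
  with assms(1) have "countable (F \<times> lists A)"
    by (intro countable_SIGMA countable_lists) (auto intro: countable_finite)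
  then have "F \<times> lists A \<lesssim> (UNIV :: nat set)"
    by (rule countable_lepoll_infinite) simp
  then show ?thesis
    using assms(2) by (rule lesspoll_trans1)
next
  case False
  with assms(1) have "F \<times> lists A \<lesssim> A"
    by (intro infinite_times_lepoll lists_lepoll_infinite countable_lepoll_infinite)
  then show ?thesis
    using assms(3) by (rule lesspoll_trans1)
qed

lemma infinite_insert_lesspoll:
  assumes "infinite K" "A \<prec> K"
  shows "insert a A \<prec> K"
proof (cases "finite A")
  case True
  with assms(1) show ?thesis
    by (intro finite_lesspoll_infinite) auto
next
  case False
  show ?thesis
    using infinite_insert_eqpoll[OF False] assms(2) by (rule eq_lesspoll_trans)
qed

lemma PiE_lepoll_Pow:
  fixes U :: "'a \<Rightarrow> 'b set" and K :: "'k set"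
  assumes "infinite K" and I: "I \<lesssim> K" and U: "\<And>i. i \<in> I \<Longrightarrow> U i \<lesssim> Pow K"
  shows "(\<Pi>\<^sub>E i\<in>I. U i) \<lesssim> Pow K"
proof -
  obtain g :: "'a \<Rightarrow> 'b \<Rightarrow> 'k set" where g: "\<And>i. i \<in> I \<Longrightarrow> inj_on (g i) (U i) \<and> g i ` U i \<subseteq> Pow K"
    using U unfolding lepoll_def by metis
  let ?graph = "\<lambda>a. SIGMA i:I. g i (a i)"
  have "inj_on ?graph (\<Pi>\<^sub>E i\<in>I. U i)"
  proof (rule inj_onI)
    fix a b assume a: "a \<in> (\<Pi>\<^sub>E i\<in>I. U i)" and b: "b \<in> (\<Pi>\<^sub>E i\<in>I. U i)" and eq: "?graph a = ?graph b"
    have "a i = b i" if i: "i \<in> I" for i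
    proof -
      have "g i (a i) = g i (b i)"
        using eq i by (auto simp: set_eq_iff)
      then show ?thesis
        using g[OF i] PiE_mem[OF a i] PiE_mem[OF b i] by (auto dest: inj_onD)
    qed
    then show "a = b"
      by (rule PiE_ext[OF a b])
  qed
  moreover have "?graph ` (\<Pi>\<^sub>E i\<in>I. U i) \<subseteq> Pow (I \<times> K)"
    using g by fastforce
  ultimately have "(\<Pi>\<^sub>E i\<in>I. U i) \<lesssim> Pow (I \<times> K)"
    unfolding lepoll_def by blast
  also have "\<dots> \<lesssim> Pow K"
    using assms(1) I by (intro Pow_lepoll_mono infinite_times_lepoll) auto
  finally show ?thesis .
qed

lemma PiE_lepoll_continuum:
  assumes I: "Pow I \<lesssim> continuum" and U: "\<And>i. i \<in> I \<Longrightarrow> U i \<lesssim> continuum"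
  shows "(\<Pi>\<^sub>E i\<in>I. U i) \<lesssim> continuum"
proof (cases "finite I")
  case True
  then have "I \<lesssim> (UNIV :: nat set)"
    by (simp add: countable_lepoll_infinite countable_finite)
  then show ?thesis
    using PiE_lepoll_Pow[of "UNIV :: nat set" I U] U by simp
next
  case False
  then have "continuum \<lesssim> Pow I"
    using Pow_lepoll_mono[of "UNIV :: nat set" I] by (simp add: infinite_le_lepoll)
  then have "(\<Pi>\<^sub>E i\<in>I. U i) \<lesssim> Pow I"
    using False U lepoll_trans by (intro PiE_lepoll_Pow) auto
  then show ?thesis
    using I by (rule lepoll_trans)
qed

lemma lesspoll_avoid:
  assumes "W \<prec> A" and unique: "\<And>w a b. w \<in> W \<Longrightarrow> a \<in> A \<Longrightarrow> b \<in> A \<Longrightarrow> R a w \<Longrightarrow> R b w \<Longrightarrow> a = b"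
  obtains a where "a \<in> A" "\<And>w. w \<in> W \<Longrightarrow> \<not> R a w"
proof (rule ccontr)
  assume "\<not> thesis"
  then have "\<forall>a\<in>A. \<exists>w\<in>W. R a w"
    using that by blast
  then obtain w where w: "\<And>a. a \<in> A \<Longrightarrow> w a \<in> W \<and> R a (w a)"
    by metis
  then have "inj_on w A"
    by (intro inj_onI) (metis unique)
  with w have "A \<lesssim> W"
    unfolding lepoll_def by blast
  with \<open>W \<prec> A\<close> show False
    using lesspoll_trans1 by blast
qed

lemma almost_disjoint_family:
  obtains Z :: "nat set \<Rightarrow> nat set"
  where "\<And>f. infinite (Z f)" "\<And>f g. f \<noteq> g \<Longrightarrow> finite (Z f \<inter> Z g)"
proof
  let ?segment = "\<lambda>f m. map (\<lambda>j. j \<in> f) [0..<m]"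
  let ?Z = "\<lambda>f. range (\<lambda>m. to_nat (?segment f m))"
  show "infinite (?Z f)" for f :: "nat set"
  proof (rule range_inj_infinite, rule injI)
    fix m n assume "to_nat (?segment f m) = to_nat (?segment f n)"
    then have "length (?segment f m) = length (?segment f n)"
      by (simp only: to_nat_split)
    then show "m = n" by simp
  qed
  show "finite (?Z f \<inter> ?Z g)" if fg: "f \<noteq> g" for f g :: "nat set"
  proof -
    obtain j where j: "j \<in> f \<longleftrightarrow> j \<notin> g"
      using fg by blast
    have "m \<le> j" if "?segment f m = ?segment g n" for m n
    proof (rule ccontr)
      assume "\<not> m \<le> j"
      moreover have "m = n"
        using arg_cong[OF that, of length] by simp
      ultimately have "j \<in> f \<longleftrightarrow> j \<in> g"
        using that by simp
      with j show False by blast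
    qed
    then have "?Z f \<inter> ?Z g \<subseteq> (\<lambda>m. to_nat (?segment f m)) ` {..j}"
      by auto
    then show ?thesis
      by (rule finite_subset) simp
  qed
qed


section \<open>Ultrafilters\<close>

definition fip_on :: "'a set \<Rightarrow> 'a set set \<Rightarrow> bool" where
  "fip_on X F \<longleftrightarrow> (\<forall>Q. finite Q \<and> Q \<subseteq> F \<longrightarrow> X \<inter> \<Inter>Q \<noteq> {})"

definition ultra_on :: "'a set \<Rightarrow> 'a set set \<Rightarrow> bool" where
  "ultra_on X G \<longleftrightarrow> fip_on X G \<and> (\<forall>S. S \<in> G \<or> X - S \<in> G)"

lemma ultra_on_finite_approx:
  assumes "ultra_on X G" "finite Q"
  shows "\<exists>a\<in>X. \<forall>S\<in>Q. a \<in> S \<longleftrightarrow> S \<in> G"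
proof -
  let ?side = "\<lambda>S. if S \<in> G then S else X - S"
  have "finite (?side ` Q)" "?side ` Q \<subseteq> G"
    using assms by (auto simp: ultra_on_def)
  then have "X \<inter> \<Inter>(?side ` Q) \<noteq> {}"
    using assms(1) unfolding ultra_on_def fip_on_def by blast
  then obtain a where a: "a \<in> X" "\<And>S. S \<in> Q \<Longrightarrow> a \<in> ?side S"
    by blast
  have "a \<in> S \<longleftrightarrow> S \<in> G" if "S \<in> Q" for S
    using a(2)[OF that] by (auto split: if_splits)
  with a(1) show ?thesis by blast
qed

lemma ultra_on_nonempty:
  assumes "ultra_on X G" "finite Q" "Q \<subseteq> G"
  shows "X \<inter> \<Inter>Q \<noteq> {}"
  using assms unfolding ultra_on_def fip_on_def by blast

lemma ultra_on_Inter: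
  assumes "ultra_on X G" "finite Q" "Q \<subseteq> G"
  shows "\<Inter>Q \<in> G"
proof -
  obtain a where "\<forall>S\<in>insert (\<Inter>Q) Q. a \<in> S \<longleftrightarrow> S \<in> G"
    using ultra_on_finite_approx[OF assms(1), of "insert (\<Inter>Q) Q"] assms(2) by auto
  with assms(3) show ?thesis by blast
qed

lemma fip_on_Union_chain:
  assumes "\<C> \<noteq> {}" "subset.chain {F. fip_on X F} \<C>"
  shows "fip_on X (\<Union>\<C>)"
  unfolding fip_on_def
proof (intro allI impI, elim conjE)
  fix Q assume Q: "finite Q" "Q \<subseteq> \<Union>\<C>"
  then obtain F where "F \<in> \<C>" "Q \<subseteq> F"
    using assms finite_subset_Union_chain by metis
  with Q(1) assms(2) show "X \<inter> \<Inter>Q \<noteq> {}"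
    by (auto simp: subset_chain_def fip_on_def)
qed

lemma not_fip_on_insertE:
  assumes "\<not> fip_on X (insert S G)"
  obtains Q where "finite Q" "Q \<subseteq> G" "X \<inter> S \<inter> \<Inter>Q = {}"
proof -
  obtain Q where Q: "finite Q" "Q \<subseteq> insert S G" "X \<inter> \<Inter>Q = {}"
    using assms unfolding fip_on_def by blast
  show thesis
  proof (rule that)
    show "finite (Q - {S})" "Q - {S} \<subseteq> G"
      using Q by auto
    show "X \<inter> S \<inter> \<Inter>(Q - {S}) = {}"
      using Q(3) by blast
  qed
qed

lemma fip_on_insert:
  assumes "fip_on X G"
  shows "fip_on X (insert S G) \<or> fip_on X (insert (X - S) G)"
proof (rule ccontr)
  assume "\<not> ?thesis"
  then have not: "\<not> fip_on X (insert S G)" "\<not> fip_on X (insert (X - S) G)"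
    by simp_all
  obtain Q where Q: "finite Q" "Q \<subseteq> G" "X \<inter> S \<inter> \<Inter>Q = {}"
    by (rule not_fip_on_insertE[OF not(1)])
  obtain Q' where Q': "finite Q'" "Q' \<subseteq> G" "X \<inter> (X - S) \<inter> \<Inter>Q' = {}"
    by (rule not_fip_on_insertE[OF not(2)])
  have "X \<inter> \<Inter>(Q \<union> Q') = {}"
    using Q(3) Q'(3) by blast
  moreover have "finite (Q \<union> Q')" "Q \<union> Q' \<subseteq> G"
    using Q Q' by simp_all
  ultimately show False
    using assms unfolding fip_on_def by blast
qed

lemma fip_on_extend_ultra:
  assumes "fip_on X F"
  obtains G where "F \<subseteq> G" "ultra_on X G"
proof -
  let ?\<A> = "{G. F \<subseteq> G \<and> fip_on X G}"
  have "\<exists>G\<in>?\<A>. \<forall>H\<in>?\<A>. G \<subseteq> H \<longrightarrow> H = G"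
  proof (rule subset_Zorn_nonempty)
    show "?\<A> \<noteq> {}" using assms by blast
    fix \<C> assume \<C>: "\<C> \<noteq> {}" "subset.chain ?\<A> \<C>"
    then have "subset.chain {G. fip_on X G} \<C>"
      by (auto simp: subset_chain_def)
    then have "fip_on X (\<Union>\<C>)"
      by (rule fip_on_Union_chain[OF \<C>(1)])
    moreover have "F \<subseteq> \<Union>\<C>"
      using \<C> by (fastforce simp: subset_chain_def)
    ultimately show "\<Union>\<C> \<in> ?\<A>" by blast
  qed
  then obtain G where G: "F \<subseteq> G" "fip_on X G"
    and maximal: "\<And>H. F \<subseteq> H \<Longrightarrow> fip_on X H \<Longrightarrow> G \<subseteq> H \<Longrightarrow> H = G"
    by auto
  have "\<forall>S. S \<in> G \<or> X - S \<in> G"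
    using fip_on_insert[OF G(2)] maximal G(1)
    by (metis insertI1 subset_insertI subset_insertI2)
  with G show thesis
    by (simp add: that ultra_on_def)
qed


section \<open>First-order logic\<close>

lemma finite_fv_tm: "finite (fv_tm t)"
  by (induction t) auto

lemma finite_fv: "finite (fv p)"
  by (induction p) (auto simp: finite_fv_tm)

lemma eval_tm_cong: "(\<And>v. v \<in> fv_tm t \<Longrightarrow> e v = e' v) \<Longrightarrow> eval_tm N e t = eval_tm N e' t"
proof (induction t)
  case (App f ts)
  then have "map (eval_tm N e) ts = map (eval_tm N e') ts"
    by (intro map_cong refl App.IH) auto
  then show ?case by (simp del: map_eq_conv)
qed simp

lemma sat_cong: "(\<And>v. v \<in> fv p \<Longrightarrow> e v = e' v) \<Longrightarrow> sat N e p \<longleftrightarrow> sat N e' p"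
proof (induction p arbitrary: e e')
  case (Eql s t)
  then have "eval_tm N e s = eval_tm N e' s" "eval_tm N e t = eval_tm N e' t"
    by (auto intro!: eval_tm_cong)
  then show ?case by simp
next
  case (Rel r ts)
  then have "map (eval_tm N e) ts = map (eval_tm N e') ts"
    by (intro map_cong refl eval_tm_cong) auto
  then show ?case by (simp del: map_eq_conv)
next
  case (Neg p)
  then have "sat N e p \<longleftrightarrow> sat N e' p"
    by (intro Neg.IH) auto
  then show ?case by simp
next
  case (Conj p q)
  have "sat N e p \<longleftrightarrow> sat N e' p" "sat N e q \<longleftrightarrow> sat N e' q"
    by (intro Conj.IH; simp add: Conj.prems)+
  then show ?case by simp
next
  case (Exists n p)
  have "sat N (e(n := a)) p \<longleftrightarrow> sat N (e'(n := a)) p" for a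
    by (rule Exists.IH) (simp add: Exists.prems)
  then show ?case by simp
qed

lemma eval_tm_in_universe:
  assumes "is_structure L N" "range e \<subseteq> universe N" "wf_tm L t"
  shows "eval_tm N e t \<in> universe N"
  using assms(3)
proof (induction t)
  case (Var n)
  then show ?case using assms(2) by auto
next
  case (App f ts)
  then have "map (eval_tm N e) ts \<in> lists (universe N)"
    by auto
  moreover have "f \<in> funs L" "length (map (eval_tm N e) ts) = fun_arity L f"
    using App.prems by auto
  ultimately show ?case
    using assms(1) by (simp only: is_structure_def eval_tm.simps)
qed

instance tm :: (countable) countable
  by countable_datatype

instance fm :: (countable, countable) countable
  by countable_datatype

lemma set_tm_subset_funs: "wf_tm L t \<Longrightarrow> set_tm t \<subseteq> funs L"
  by (induction t) auto

lemma set_fm_subset: "wf_fm L p \<Longrightarrow> set1_fm p \<subseteq> funs L \<and> set2_fm p \<subseteq> rels L"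
  using set_tm_subset_funs by (induction p) (simp_all, blast+)

lemma countable_wf_fm:
  assumes "countable_language L"
  shows "countable {p. wf_fm L p}"
proof (rule countable_image_inj_on)
  let ?f = "map_fm (to_nat_on (funs L)) (to_nat_on (rels L))"
  let ?g = "map_fm (from_nat_into (funs L)) (from_nat_into (rels L))"
  show "countable (?f ` {p. wf_fm L p})"
    by simp
  show "inj_on ?f {p. wf_fm L p}"
  proof (rule inj_on_inverseI)
    fix p assume "p \<in> {p. wf_fm L p}"
    then have "set1_fm p \<subseteq> funs L" "set2_fm p \<subseteq> rels L"
      using set_fm_subset by blast+
    moreover have "countable (funs L)" "countable (rels L)"
      using assms by (auto simp: countable_language_def)
    ultimately show "?g (?f p) = p"
      unfolding fm.map_comp by (intro fm.map_ident_strong) (simp_all add: subset_iff)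
  qed
qed

lemma stable_theory_of_no_order:
  fixes N :: "('f, 'r, 'a) struct"
  assumes "stable TYPE('a) L (theory_of L N)" and "is_structure L N" and "wf_fm L p"
    and "range a \<subseteq> universe N" and "\<forall>j. range (b j) \<subseteq> universe N"
  shows "\<not> (\<forall>i j. sat N ((b j)(n := a i)) p \<longleftrightarrow> i \<le> (j :: nat))"
proof
  assume "\<forall>i j. sat N ((b j)(n := a i)) p \<longleftrightarrow> i \<le> j"
  then have order: "sat N (override_on (b j) (\<lambda>_. a i) {n}) p \<longleftrightarrow> i \<le> j" for i j
    by (simp add: override_on_insert)
  have "order_property TYPE('a) L (theory_of L N) {n} p"
    unfolding order_property_def
  proof (rule allI, intro exI conjI)
    show "is_model L (theory_of L N) N"
      using assms(2) by (auto simp: is_model_def theory_of_def)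
    show "\<forall>i<k. range (\<lambda>_::nat. a i) \<subseteq> universe N \<and> range (b i) \<subseteq> universe N" for k
      using assms(4,5) by auto
  qed (simp add: order)
  then show False
    using assms(1,3) unfolding stable_def by blast
qed


subsection \<open>Definable sets and types\<close>

definition defset :: "('f, 'r, 'a) struct \<Rightarrow> ('f, 'r) fm \<Rightarrow> (nat \<Rightarrow> 'a) \<Rightarrow> 'a set" where
  "defset N p e = {c \<in> universe N. sat N (e(0 := c)) p}"

definition defsets :: "('f, 'r, 'a) struct \<Rightarrow> ('f, 'r) fm set \<Rightarrow> 'a set \<Rightarrow> 'a set set" where
  "defsets N \<Phi> A = {defset N p e | p e. p \<in> \<Phi> \<and> range e \<subseteq> A}"

definition linked :: "('f, 'r, 'a) struct \<Rightarrow> ('f, 'r) fm \<Rightarrow> 'a \<Rightarrow> 'a \<Rightarrow> bool" where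
  "linked N p u v \<longleftrightarrow> (\<exists>e. range e \<subseteq> universe N \<and> u \<in> defset N p e \<and> v \<in> defset N p e)"

lemma defsetsI: "p \<in> \<Phi> \<Longrightarrow> range e \<subseteq> A \<Longrightarrow> defset N p e \<in> defsets N \<Phi> A"
  unfolding defsets_def by blast

lemma linkedI: "range e \<subseteq> universe N \<Longrightarrow> u \<in> defset N p e \<Longrightarrow> v \<in> defset N p e \<Longrightarrow> linked N p u v"
  unfolding linked_def by blast

lemma defset_cong: "(\<And>v. v \<in> fv p - {0} \<Longrightarrow> e v = e' v) \<Longrightarrow> defset N p e = defset N p e'"
  unfolding defset_def by (intro Collect_cong conj_cong refl sat_cong) auto

lemma defset_in_defsets_if_param_fms:
  assumes "(p, e) \<in> param_fms L A"
  shows "defset N p e \<in> defsets N {p. wf_fm L p} (insert a A)"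
proof -
  let ?e = "\<lambda>v. if v \<in> fv p - {0} then e v else a"
  have "range ?e \<subseteq> insert a A" "wf_fm L p"
    using assms by (auto simp: param_fms_def)
  moreover have "defset N p e = defset N p ?e"
    by (rule defset_cong) simp
  ultimately show ?thesis
    unfolding defsets_def by blast
qed

lemma defsets_lepoll:
  assumes "A \<noteq> {}"
  shows "defsets N \<Phi> A \<lesssim> \<Phi> \<times> lists A"
proof -
  obtain a where "a \<in> A"
    using assms by blast
  let ?e = "\<lambda>as v. if v < length as then as ! v else a"
  have "defset N p e \<in> (\<lambda>(p, as). defset N p (?e as)) ` (\<Phi> \<times> lists A)"
    if p: "p \<in> \<Phi>" and e: "range e \<subseteq> A" for p e
  proof -
    obtain m where m: "\<And>v. v \<in> fv p \<Longrightarrow> v < m"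
      using finite_fv[of p] unfolding finite_nat_set_iff_bounded by blast
    have "defset N p e = defset N p (?e (map e [0..<m]))"
      by (rule defset_cong) (use m in auto)
    moreover have "(p, map e [0..<m]) \<in> \<Phi> \<times> lists A"
      using p e by (auto simp: image_subset_iff)
    ultimately show ?thesis
      by (intro image_eqI[of _ _ "(p, map e [0..<m])"]) auto
  qed
  then have "defsets N \<Phi> A \<subseteq> (\<lambda>(p, as). defset N p (?e as)) ` (\<Phi> \<times> lists A)"
    unfolding defsets_def by blast
  then show ?thesis
    by (rule subset_image_lepoll)
qed

lemma realises_iff_defset:
  "realises N c P \<longleftrightarrow> c \<in> universe N \<and> (\<forall>(p, e)\<in>P. c \<in> defset N p e)"
  by (auto simp: realises_def defset_def)

lemma consistent_fip_on:
  assumes "consistent N P"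
  shows "fip_on (universe N) ((\<lambda>(p, e). defset N p e) ` P)"
  unfolding fip_on_def
proof (intro allI impI, elim conjE)
  fix Q assume "finite Q" "Q \<subseteq> (\<lambda>(p, e). defset N p e) ` P"
  then obtain P' where P': "finite P'" "P' \<subseteq> P" "Q = (\<lambda>(p, e). defset N p e) ` P'"
    using finite_subset_image by metis
  then obtain c where "realises N c P'"
    using assms unfolding consistent_def by blast
  then have "c \<in> universe N \<inter> \<Inter>Q"
    unfolding P'(3) realises_iff_defset by auto
  then show "universe N \<inter> \<Inter>Q \<noteq> {}" by blast
qed

lemma card_saturated_if_ultra_realised:
  assumes "infinite K"
    and ultra: "\<And>A G. A \<subseteq> universe N \<Longrightarrow> A \<noteq> {} \<Longrightarrow> A \<prec> K \<Longrightarrow> ultra_on (universe N) G \<Longrightarrow>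
      \<exists>c\<in>universe N. \<forall>S \<in> defsets N {p. wf_fm L p} A. S \<in> G \<longrightarrow> c \<in> S"
  shows "card_saturated L K N"
  unfolding card_saturated_def
proof (intro allI impI, elim conjE)
  fix A P assume A: "A \<subseteq> universe N" "A \<prec> K" and P: "P \<subseteq> param_fms L A" "consistent N P"
  from P(2) obtain a where a: "a \<in> universe N"
    unfolding consistent_def realises_def by blast
  obtain G where G: "(\<lambda>(p, e). defset N p e) ` P \<subseteq> G" "ultra_on (universe N) G"
    by (rule fip_on_extend_ultra[OF consistent_fip_on[OF P(2)]])
  have "\<exists>c\<in>universe N. \<forall>S \<in> defsets N {p. wf_fm L p} (insert a A). S \<in> G \<longrightarrow> c \<in> S"
    using a A(1) by (intro ultra infinite_insert_lesspoll[OF assms(1) A(2)] G(2)) auto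
  then obtain c where c: "c \<in> universe N"
      "\<And>S. S \<in> defsets N {p. wf_fm L p} (insert a A) \<Longrightarrow> S \<in> G \<Longrightarrow> c \<in> S"
    by blast
  have "c \<in> defset N p e" if "(p, e) \<in> P" for p e
    using that P(1) G(1) by (intro c(2) defset_in_defsets_if_param_fms) auto
  then show "\<exists>c. realises N c P"
    using c(1) by (auto simp: realises_iff_defset)
qed


section \<open>Layered ideals\<close>

lemma ideal_onD:
  assumes "ideal_on I J"
  shows "{} \<in> J" "A \<in> J \<Longrightarrow> A \<subseteq> I" "A \<in> J \<Longrightarrow> B \<subseteq> A \<Longrightarrow> B \<in> J"
    "A \<in> J \<Longrightarrow> B \<in> J \<Longrightarrow> A \<union> B \<in> J"
  using assms unfolding ideal_on_def by blast+

lemma ideal_on_Diff_iff: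
  assumes "ideal_on I J" "C \<in> J"
  shows "A - C \<in> J \<longleftrightarrow> A \<in> J"
proof
  assume "A - C \<in> J"
  then have "(A - C) \<union> C \<in> J"
    using assms(2) by (rule ideal_onD(4)[OF assms(1)])
  then show "A \<in> J"
    by (rule ideal_onD(3)[OF assms(1)]) blast
qed (rule ideal_onD(3)[OF assms(1)], auto)

definition dual_filter :: "'i set \<Rightarrow> 'i set set \<Rightarrow> 'i filter" where
  "dual_filter I J = Abs_filter (\<lambda>P. {i \<in> I. \<not> P i} \<in> J)"

lemma eventually_dual_filter:
  assumes J: "ideal_on I J"
  shows "eventually P (dual_filter I J) \<longleftrightarrow> {i \<in> I. \<not> P i} \<in> J"
  unfolding dual_filter_def
proof (rule eventually_Abs_filter, unfold_locales)
  show "{i \<in> I. \<not> True} \<in> J"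
    by (simp add: ideal_onD(1)[OF J])
next
  fix P Q assume "{i \<in> I. \<not> P i} \<in> J" "{i \<in> I. \<not> Q i} \<in> J"
  then have "{i \<in> I. \<not> P i} \<union> {i \<in> I. \<not> Q i} \<in> J"
    by (rule ideal_onD(4)[OF J])
  then show "{i \<in> I. \<not> (P i \<and> Q i)} \<in> J"
    by (rule ideal_onD(3)[OF J]) blast
next
  fix P Q assume imp: "\<forall>i. P i \<longrightarrow> Q i" and "{i \<in> I. \<not> P i} \<in> J"
  from this(2) show "{i \<in> I. \<not> Q i} \<in> J"
    by (rule ideal_onD(3)[OF J]) (use imp in blast)
qed

lemma frequently_dual_filter:
  assumes "ideal_on I J"
  shows "frequently P (dual_filter I J) \<longleftrightarrow> {i \<in> I. P i} \<notin> J"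
  by (simp add: frequently_def eventually_dual_filter[OF assms])

lemma eventually_dual_filter_mem:
  assumes "ideal_on I J"
  shows "\<forall>\<^sub>F i in dual_filter I J. i \<in> I"
  by (simp add: eventually_dual_filter[OF assms] ideal_onD(1)[OF assms] cong: conj_cong)

lemma layered_ideal: "layered I J \<Longrightarrow> ideal_on I J"
  by (simp add: layered_def)

lemma layered_exhaustion:
  assumes "layered I J"
  obtains K :: "nat \<Rightarrow> 'i set" where "\<And>n. K n \<in> J" "(\<Union>n. K n) = (I :: 'i set)"
proof -
  obtain C where C: "C \<subseteq> J" "countable C" "\<Union>C = I"
    using assms unfolding layered_def by blast
  let ?K = "from_nat_into (insert {} C)"
  show thesis
  proof (rule that)
    have "?K n \<in> insert {} C" for n
      by (rule from_nat_into) simp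
    then show "?K n \<in> J" for n
      using C(1) ideal_onD(1)[OF layered_ideal[OF assms]] by (metis insertE subsetD)
    have "range ?K = insert {} C"
      using C(2) by (intro range_from_nat_into) auto
    then show "(\<Union>n. ?K n) = I"
      using C(3) by simp
  qed
qed

definition layering :: "'i set \<Rightarrow> 'i set set \<Rightarrow> ('i set \<Rightarrow> ennreal) \<Rightarrow> bool" where
  "layering I J \<mu> \<longleftrightarrow> ideal_on I J \<and> (\<forall>A B. A \<subseteq> B \<and> B \<subseteq> I \<longrightarrow> \<mu> A \<le> \<mu> B) \<and>
    (\<forall>A\<in>J. \<mu> A < \<infinity>) \<and> (\<forall>A\<subseteq>I. A \<notin> J \<longrightarrow> (\<forall>n::nat. \<exists>B\<in>J. B \<subseteq> A \<and> of_nat n < \<mu> B))"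

lemma layered_layering:
  assumes "layered I J"
  obtains \<mu> where "layering I J \<mu>"
proof -
  from assms obtain \<mu> :: "'a set \<Rightarrow> ennreal" where
    mono: "\<forall>A B. A \<subseteq> B \<and> B \<subseteq> I \<longrightarrow> \<mu> A \<le> \<mu> B" and
    fin: "J = {A. A \<subseteq> I \<and> \<mu> A < \<infinity>}" and
    approx: "\<forall>A\<subseteq>I. A \<notin> J \<longleftrightarrow> (SUP B \<in> {B. B \<subseteq> A \<and> B \<in> J}. \<mu> B) = \<infinity>"
    unfolding layered_def by (elim conjE exE) (rule that)
  have "\<exists>B\<in>J. B \<subseteq> A \<and> of_nat n < \<mu> B" if "A \<subseteq> I" "A \<notin> J" for A and n :: nat
  proof -
    have "(SUP B \<in> {B. B \<subseteq> A \<and> B \<in> J}. \<mu> B) = \<infinity>"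
      using approx that by blast
    then have "of_nat n < (SUP B \<in> {B. B \<subseteq> A \<and> B \<in> J}. \<mu> B)"
      by (simp only: infinity_ennreal_def of_nat_less_top)
    then show ?thesis
      unfolding less_SUP_iff by blast
  qed
  moreover have "\<forall>A\<in>J. \<mu> A < \<infinity>"
    using fin by simp
  ultimately show thesis
    using layered_ideal[OF assms] mono by (intro that[of \<mu>]) (simp only: layering_def, blast)
qed

lemma layering_step:
  assumes \<mu>: "layering I J \<mu>" and "C \<in> J" "K \<in> J" "T \<subseteq> I"
  shows "\<exists>C'\<in>J. C \<subseteq> C' \<and> K \<subseteq> C' \<and> (T \<notin> J \<longrightarrow> of_nat n < \<mu> (T \<inter> (C' - C)))"
proof -
  have J: "ideal_on I J"
    using \<mu> by (simp add: layering_def)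
  have CK: "C \<union> K \<in> J"
    by (rule ideal_onD(4)[OF J assms(2,3)])
  show ?thesis
  proof (cases "T \<in> J")
    case True
    then show ?thesis
      using CK by blast
  next
    case False
    then have "T - C \<notin> J"
      by (simp add: ideal_on_Diff_iff[OF J assms(2)])
    moreover have "T - C \<subseteq> I"
      using assms(4) by blast
    ultimately obtain B where B: "B \<in> J" "B \<subseteq> T - C" "of_nat n < \<mu> B"
      using \<mu> unfolding layering_def by blast
    let ?C = "C \<union> K \<union> B"
    have "B \<subseteq> T \<inter> (?C - C)" "T \<inter> (?C - C) \<subseteq> I"
      using B(2) assms(4) by auto
    then have "\<mu> B \<le> \<mu> (T \<inter> (?C - C))"
      using \<mu> by (simp add: layering_def)
    with B(3) have "of_nat n < \<mu> (T \<inter> (?C - C))"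
      by (rule less_le_trans)
    moreover have "?C \<in> J"
      by (rule ideal_onD(4)[OF J CK B(1)])
    ultimately show ?thesis
      by (intro bexI[of _ ?C] conjI impI) blast+
  qed
qed

lemma layering_unbounded:
  assumes \<mu>: "layering I J \<mu>" and Z: "infinite Z"
    and S: "\<And>n. n \<in> Z \<Longrightarrow> S n \<subseteq> X \<and> of_nat n < \<mu> (S n)"
  shows "X \<notin> J"
proof
  assume X: "X \<in> J"
  then have "\<mu> X < \<infinity>" "X \<subseteq> I"
    using \<mu> ideal_onD(2) by (auto simp: layering_def)
  then obtain m :: nat where m: "\<mu> X < of_nat m"
    using ennreal_Ex_less_of_nat by auto
  obtain n where n: "n \<in> Z" "m \<le> n"
    using Z by (meson infinite_nat_iff_unbounded_le)
  have "of_nat n < \<mu> (S n)"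
    using S n(1) by blast
  also have "\<dots> \<le> \<mu> X"
    using \<mu> S[OF n(1)] \<open>X \<subseteq> I\<close> by (simp add: layering_def)
  also have "\<dots> < of_nat m" by (fact m)
  finally show False
    using n(2) by simp
qed

text \<open>The piece of \<open>T n\<close> between \<open>C n\<close> and \<open>C (Suc n)\<close> is chosen to have measure above \<open>n\<close>.\<close>

lemma layered_tower:
  assumes lay: "layered I J" and K: "\<And>n. K n \<in> J" and T: "\<And>n. T n \<subseteq> I"
  obtains C where "\<And>n. C n \<in> J" "incseq C" "\<And>n. K n \<subseteq> C n"
    "\<And>Z. infinite Z \<Longrightarrow> \<forall>n\<in>Z. T n \<notin> J \<Longrightarrow> (\<Union>n\<in>Z. T n \<inter> (C (Suc n) - C n)) \<notin> J"
proof -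
  obtain \<mu> where \<mu>: "layering I J \<mu>"
    by (rule layered_layering[OF lay])
  have "\<exists>C. \<forall>n. (C n \<in> J \<and> K n \<subseteq> C n) \<and>
      (C n \<subseteq> C (Suc n) \<and> (T n \<notin> J \<longrightarrow> of_nat n < \<mu> (T n \<inter> (C (Suc n) - C n))))"
  proof (rule dependent_nat_choice)
    show "\<exists>C. C \<in> J \<and> K 0 \<subseteq> C"
      using K by blast
    show "\<exists>C'. (C' \<in> J \<and> K (Suc n) \<subseteq> C') \<and>
        (C \<subseteq> C' \<and> (T n \<notin> J \<longrightarrow> of_nat n < \<mu> (T n \<inter> (C' - C))))"
      if "C \<in> J \<and> K n \<subseteq> C" for C n
      using layering_step[OF \<mu> conjunct1[OF that] K T, of "Suc n" n n] by blast
  qed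
  then obtain C where "\<forall>n. (C n \<in> J \<and> K n \<subseteq> C n) \<and>
      (C n \<subseteq> C (Suc n) \<and> (T n \<notin> J \<longrightarrow> of_nat n < \<mu> (T n \<inter> (C (Suc n) - C n))))" ..
  then have C: "C n \<in> J" "K n \<subseteq> C n" "C n \<subseteq> C (Suc n)"
      "T n \<notin> J \<Longrightarrow> of_nat n < \<mu> (T n \<inter> (C (Suc n) - C n))" for n
    by simp_all
  show thesis
  proof (rule that)
    show "incseq C" using C(3) by (rule incseq_SucI)
    show "(\<Union>n\<in>Z. T n \<inter> (C (Suc n) - C n)) \<notin> J" if Z: "infinite Z" "\<forall>n\<in>Z. T n \<notin> J" for Z
      by (rule layering_unbounded[OF \<mu> Z(1)]) (use C(4) Z(2) in blast)
  qed (fact C)+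
qed

lemma Least_mem_incseq_le_iff:
  assumes "incseq C" "i \<in> (\<Union>n. C n)"
  shows "(LEAST n. i \<in> C n) \<le> n \<longleftrightarrow> i \<in> C n"
proof
  obtain m where "i \<in> C m" using assms(2) by blast
  then have "i \<in> C (LEAST n. i \<in> C n)" by (rule LeastI)
  then show "i \<in> C n" if "(LEAST n. i \<in> C n) \<le> n"
    using incseqD[OF assms(1) that] by blast
qed (rule Least_le)

lemma layered_level:
  fixes I :: "'i set" and D P :: "nat \<Rightarrow> 'i \<Rightarrow> bool"
  assumes lay: "layered I J" and D: "\<And>n. \<forall>\<^sub>F i in dual_filter I J. D n i"
  obtains h :: "'i \<Rightarrow> nat" where "\<And>n. \<forall>\<^sub>F i in dual_filter I J. n < h i"
    "\<And>n i. i \<in> I \<Longrightarrow> n < h i \<Longrightarrow> D n i"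
    "\<And>Z. infinite Z \<Longrightarrow> \<forall>n\<in>Z. \<exists>\<^sub>F i in dual_filter I J. P n i \<Longrightarrow>
      \<exists>\<^sub>F i in dual_filter I J. \<exists>n\<in>Z. h i = Suc n \<and> P n i"
proof -
  note J = layered_ideal[OF lay]
  note filter_simps = eventually_dual_filter[OF J] frequently_dual_filter[OF J]
  obtain K :: "nat \<Rightarrow> 'i set" where K: "\<And>n. K n \<in> J" "(\<Union>n. K n) = I"
    by (rule layered_exhaustion[OF lay]) (rule that)
  have KD: "K n \<union> {i \<in> I. \<not> D n i} \<in> J" for n
    using K(1) D by (intro ideal_onD(4)[OF J]) (simp_all add: filter_simps)
  obtain C where C: "\<And>n. C n \<in> J" "incseq C" "\<And>n. K n \<union> {i \<in> I. \<not> D n i} \<subseteq> C n"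
    and pos: "\<And>Z. infinite Z \<Longrightarrow> \<forall>n\<in>Z. {i \<in> I. P n i} \<notin> J \<Longrightarrow>
      (\<Union>n\<in>Z. {i \<in> I. P n i} \<inter> (C (Suc n) - C n)) \<notin> J"
    by (rule layered_tower[OF lay KD, of "\<lambda>n. {i \<in> I. P n i}"]) (blast, rule that)
  define h where "h i = (LEAST n. i \<in> C n)" for i
  have h_le_iff: "h i \<le> n \<longleftrightarrow> i \<in> C n" if "i \<in> I" for i n
    unfolding h_def by (rule Least_mem_incseq_le_iff[OF C(2)]) (use that K(2) C(3) in fast)
  show thesis
  proof (rule that)
    show "\<forall>\<^sub>F i in dual_filter I J. n < h i" for n
      unfolding filter_simps
      by (rule ideal_onD(3)[OF J C(1)[of n]]) (auto simp: not_less h_le_iff)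
    show "D n i" if "i \<in> I" "n < h i" for n i
      using that C(3)[of n] h_le_iff[of i n] by auto
    show "\<exists>\<^sub>F i in dual_filter I J. \<exists>n\<in>Z. h i = Suc n \<and> P n i"
      if Z: "infinite Z" "\<forall>n\<in>Z. \<exists>\<^sub>F i in dual_filter I J. P n i" for Z
    proof -
      have "h i = Suc n" if "i \<in> I" "i \<in> C (Suc n)" "i \<notin> C n" for i n
        using that h_le_iff[of i n] h_le_iff[of i "Suc n"] by simp
      then have "(\<Union>n\<in>Z. {i \<in> I. P n i} \<inter> (C (Suc n) - C n)) \<subseteq> {i \<in> I. \<exists>n\<in>Z. h i = Suc n \<and> P n i}"
        by blast
      then show ?thesis
        using pos[OF Z(1)] Z(2) ideal_onD(3)[OF J] unfolding filter_simps by meson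
    qed
  qed
qed

definition colour :: "'k set \<Rightarrow> nat \<Rightarrow> 'k" where
  "colour K n = from_nat_into K (fst (prod_decode n))"

lemma infinite_colour_class:
  assumes "countable K" "k \<in> K" "infinite A"
  shows "infinite {n. colour K n = k \<and> snd (prod_decode n) \<in> A}"
proof -
  have "infinite ((\<lambda>m. prod_encode (to_nat_on K k, m)) ` A)"
    using assms(3) by (subst finite_image_iff) (auto simp: inj_on_def)
  then show ?thesis
    by (rule infinite_super[rotated]) (use assms(1,2) in \<open>auto simp: colour_def\<close>)
qed

lemma layered_colouring:
  fixes I :: "'i set" and K :: "'k set"
  assumes lay: "layered I J" and K: "countable K"
    and P: "\<forall>k\<in>K. \<exists>\<^sub>F i in dual_filter I J. P k i"
  obtains s :: "'i \<Rightarrow> 'k" where "\<forall>k\<in>K. \<exists>\<^sub>F i in dual_filter I J. s i = k \<and> P k i"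
proof -
  obtain h :: "'i \<Rightarrow> nat" where h: "\<And>Z. infinite Z \<Longrightarrow>
      \<forall>n\<in>Z. \<exists>\<^sub>F i in dual_filter I J. P (colour K n) i \<Longrightarrow>
      \<exists>\<^sub>F i in dual_filter I J. \<exists>n\<in>Z. h i = Suc n \<and> P (colour K n) i"
    by (rule layered_level[OF lay, of "\<lambda>_ _. True" "\<lambda>n. P (colour K n)"]) (simp, rule that)
  have "\<exists>\<^sub>F i in dual_filter I J. colour K (h i - 1) = k \<and> P k i" if k: "k \<in> K" for k
  proof -
    let ?Z = "{n. colour K n = k \<and> snd (prod_decode n) \<in> UNIV}"
    have "infinite ?Z"
      using K k by (rule infinite_colour_class) simp
    then have "\<exists>\<^sub>F i in dual_filter I J. \<exists>n\<in>?Z. h i = Suc n \<and> P (colour K n) i"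
      by (rule h) (use P k in auto)
    then show ?thesis
      by (rule frequently_elim1) auto
  qed
  then show thesis
    by (intro that[of "\<lambda>i. colour K (h i - 1)"]) blast
qed

lemma PiE_choice:
  assumes "\<forall>i\<in>I. \<exists>u\<in>U i. Q i u"
  obtains a where "a \<in> (\<Pi>\<^sub>E i\<in>I. U i)" "\<forall>i\<in>I. Q i (a i)"
proof -
  obtain a where "\<forall>i\<in>I. a i \<in> U i \<and> Q i (a i)"
    using assms by metis
  then show thesis
    by (intro that[of "restrict a I"]) auto
qed

text \<open>As a colouring yields disjoint positive sets, the choices for the individual \<open>k\<close> do not interfere.\<close>

lemma layered_selection:
  fixes I :: "'i set" and K :: "'k set"
  assumes lay: "layered I J" and K: "countable K" and U: "\<And>i. i \<in> I \<Longrightarrow> U i \<noteq> {}"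
    and P: "\<forall>\<^sub>F i in dual_filter I J. \<exists>u\<in>U i. P i u"
    and Q: "\<forall>k\<in>K. \<exists>\<^sub>F i in dual_filter I J. \<exists>u\<in>U i. P i u \<and> Q k i u"
  obtains a where "a \<in> (\<Pi>\<^sub>E i\<in>I. U i)" "\<forall>\<^sub>F i in dual_filter I J. P i (a i)"
    "\<forall>k\<in>K. \<exists>\<^sub>F i in dual_filter I J. Q k i (a i)"
proof -
  note mem = eventually_dual_filter_mem[OF layered_ideal[OF lay]]
  obtain s :: "'i \<Rightarrow> 'k" where
    s: "\<forall>k\<in>K. \<exists>\<^sub>F i in dual_filter I J. s i = k \<and> (\<exists>u\<in>U i. P i u \<and> Q k i u)"
    by (rule layered_colouring[OF lay K Q])
  have "\<forall>i\<in>I. \<exists>u\<in>U i. ((\<exists>v\<in>U i. P i v) \<longrightarrow> P i u) \<and>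
      ((\<exists>v\<in>U i. P i v \<and> Q (s i) i v) \<longrightarrow> Q (s i) i u)"
    using U by blast
  then obtain a where a: "a \<in> (\<Pi>\<^sub>E i\<in>I. U i)" "\<forall>i\<in>I. ((\<exists>v\<in>U i. P i v) \<longrightarrow> P i (a i)) \<and>
      ((\<exists>v\<in>U i. P i v \<and> Q (s i) i v) \<longrightarrow> Q (s i) i (a i))"
    by (rule PiE_choice)
  show thesis
  proof (rule that[OF a(1)])
    show "\<forall>\<^sub>F i in dual_filter I J. P i (a i)"
      using P mem by eventually_elim (use a(2) in blast)
    show "\<forall>k\<in>K. \<exists>\<^sub>F i in dual_filter I J. Q k i (a i)"
    proof
      fix k assume "k \<in> K"
      from frequently_eventually_frequently[OF s[rule_format, OF this] mem]
      show "\<exists>\<^sub>F i in dual_filter I J. Q k i (a i)"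
        by (rule frequently_elim1) (use a(2) in blast)
    qed
  qed
qed

lemma layered_unrelated_pair:
  fixes I :: "'i set" and Y :: "nat \<Rightarrow> 'i \<Rightarrow> 'a set"
  assumes lay: "layered I J" and Y0: "\<And>i. i \<in> I \<Longrightarrow> Y 0 i \<noteq> {}"
    and ne: "\<And>n. \<forall>\<^sub>F i in dual_filter I J. Y n i \<noteq> {}"
  obtains l u v where "\<And>n. \<forall>\<^sub>F i in dual_filter I J. n \<le> l i"
    "\<And>i. i \<in> I \<Longrightarrow> u i \<in> Y (l i) i \<and> v i \<in> Y (l i) i"
    "\<And>Z. infinite Z \<Longrightarrow> \<forall>n\<in>Z. \<exists>\<^sub>F i in dual_filter I J. \<exists>u\<in>Y n i. \<exists>v\<in>Y n i. \<not> R n i u v \<Longrightarrow>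
      \<exists>\<^sub>F i in dual_filter I J. l i \<in> Z \<and> \<not> R (l i) i (u i) (v i)"
proof -
  note mem = eventually_dual_filter_mem[OF layered_ideal[OF lay]]
  let ?unrelated = "\<lambda>n i. \<exists>u\<in>Y n i. \<exists>v\<in>Y n i. \<not> R n i u v"
  obtain h :: "'i \<Rightarrow> nat" where h: "\<And>n. \<forall>\<^sub>F i in dual_filter I J. n < h i"
      "\<And>n i. i \<in> I \<Longrightarrow> n < h i \<Longrightarrow> Y n i \<noteq> {}"
      "\<And>Z. infinite Z \<Longrightarrow> \<forall>n\<in>Z. \<exists>\<^sub>F i in dual_filter I J. ?unrelated n i \<Longrightarrow>
        \<exists>\<^sub>F i in dual_filter I J. \<exists>n\<in>Z. h i = Suc n \<and> ?unrelated n i"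
    by (rule layered_level[OF lay ne, where P = ?unrelated]) (rule that)
  define l where "l i = h i - 1" for i
  have "Y (l i) i \<noteq> {}" if "i \<in> I" for i
    using Y0[OF that] h(2)[OF that, of "l i"] by (cases "h i") (simp_all add: l_def)
  then have "\<exists>u v. u \<in> Y (l i) i \<and> v \<in> Y (l i) i \<and> (?unrelated (l i) i \<longrightarrow> \<not> R (l i) i u v)"
    if "i \<in> I" for i
    using that by blast
  then obtain u v where uv: "\<And>i. i \<in> I \<Longrightarrow> u i \<in> Y (l i) i \<and> v i \<in> Y (l i) i \<and>
      (?unrelated (l i) i \<longrightarrow> \<not> R (l i) i (u i) (v i))"
    by metis
  show thesis
  proof (rule that)
    show "\<forall>\<^sub>F i in dual_filter I J. n \<le> l i" for n
      using h(1)[of n] by eventually_elim (simp add: l_def)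
    show "u i \<in> Y (l i) i \<and> v i \<in> Y (l i) i" if "i \<in> I" for i
      using uv[OF that] by blast
    fix Z assume "infinite Z" "\<forall>n\<in>Z. \<exists>\<^sub>F i in dual_filter I J. ?unrelated n i"
    then have "\<exists>\<^sub>F i in dual_filter I J. \<exists>n\<in>Z. h i = Suc n \<and> ?unrelated n i"
      by (rule h(3))
    then have "\<exists>\<^sub>F i in dual_filter I J. l i \<in> Z \<and> ?unrelated (l i) i"
      by (rule frequently_elim1) (metis diff_Suc_1 l_def)
    from frequently_eventually_frequently[OF this mem]
    show "\<exists>\<^sub>F i in dual_filter I J. l i \<in> Z \<and> \<not> R (l i) i (u i) (v i)"
      by (rule frequently_elim1) (use uv in blast)
  qed
qed

text \<open>
  On the level \<open>l i = n\<close>, where \<open>n\<close> codes \<open>k \<in> K\<close> and \<open>m\<close>, all \<open>x f\<close> take one of two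
  \<open>R k\<close>-unrelated values, and \<open>m \<in> Z f\<close> decides which one.
\<close>

lemma layered_continuum_unrelated:
  fixes I :: "'i set" and K :: "'k set" and Y :: "nat \<Rightarrow> 'i \<Rightarrow> 'a set"
  assumes lay: "layered I J" and K: "countable K"
    and Y0: "\<And>i. i \<in> I \<Longrightarrow> Y 0 i \<noteq> {}" and dec: "\<And>i. decseq (\<lambda>n. Y n i)"
    and ne: "\<And>n. \<forall>\<^sub>F i in dual_filter I J. Y n i \<noteq> {}"
    and unrelated: "\<And>n k. k \<in> K \<Longrightarrow> \<exists>\<^sub>F i in dual_filter I J. \<exists>u\<in>Y n i. \<exists>v\<in>Y n i. \<not> R k i u v"
  obtains x :: "nat set \<Rightarrow> 'i \<Rightarrow> 'a" where "\<And>f. x f \<in> (\<Pi>\<^sub>E i\<in>I. Y 0 i)"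
    "\<And>f n. \<forall>\<^sub>F i in dual_filter I J. x f i \<in> Y n i"
    "\<And>f g k. f \<noteq> g \<Longrightarrow> k \<in> K \<Longrightarrow> \<exists>\<^sub>F i in dual_filter I J. \<not> R k i (x f i) (x g i)"
proof -
  note mem = eventually_dual_filter_mem[OF layered_ideal[OF lay]]
  obtain Z :: "nat set \<Rightarrow> nat set" where Z: "\<And>f. infinite (Z f)" "\<And>f g. f \<noteq> g \<Longrightarrow> finite (Z f \<inter> Z g)"
    by (rule almost_disjoint_family) (rule that)
  obtain l u v where l: "\<And>n. \<forall>\<^sub>F i in dual_filter I J. n \<le> l i"
    and uv: "\<And>i. i \<in> I \<Longrightarrow> u i \<in> Y (l i) i \<and> v i \<in> Y (l i) i"
    and uv_unrelated: "\<And>Z. infinite Z \<Longrightarrow>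
      \<forall>n\<in>Z. \<exists>\<^sub>F i in dual_filter I J. \<exists>u\<in>Y n i. \<exists>v\<in>Y n i. \<not> R (colour K n) i u v \<Longrightarrow>
      \<exists>\<^sub>F i in dual_filter I J. l i \<in> Z \<and> \<not> R (colour K (l i)) i (u i) (v i)"
    by (rule layered_unrelated_pair[where Y = Y and R = "\<lambda>n. R (colour K n)", OF lay Y0 ne])
      (assumption, rule that)
  define x where "x f = (\<lambda>i\<in>I. if snd (prod_decode (l i)) \<in> Z f then u i else v i)" for f
  have x_Y: "x f i \<in> Y n i" if "i \<in> I" "n \<le> l i" for f i n
    using uv[OF that(1)] decseqD[OF dec that(2)] that(1) by (auto simp: x_def)
  show thesis
  proof (rule that)
    show "x f \<in> (\<Pi>\<^sub>E i\<in>I. Y 0 i)" for f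
      using x_Y[of _ 0 f] by (auto simp: x_def)
    show "\<forall>\<^sub>F i in dual_filter I J. x f i \<in> Y n i" for f n
      using l[of n] mem by eventually_elim (rule x_Y)
    show "\<exists>\<^sub>F i in dual_filter I J. \<not> R k i (x f i) (x g i)" if "f \<noteq> g" and k: "k \<in> K" for f g k
    proof -
      let ?N = "{n. colour K n = k \<and> snd (prod_decode n) \<in> Z f - Z g}"
      have "infinite (Z f - Z g)"
        using Z(1)[of f] Z(2)[OF \<open>f \<noteq> g\<close>] by (metis Diff_Diff_Int Diff_infinite_finite)
      with K k have "infinite ?N"
        by (rule infinite_colour_class)
      then have "\<exists>\<^sub>F i in dual_filter I J. l i \<in> ?N \<and> \<not> R (colour K (l i)) i (u i) (v i)"
        by (rule uv_unrelated) (use unrelated[OF k] in simp)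
      from frequently_eventually_frequently[OF this mem] show ?thesis
        by (rule frequently_elim1) (auto simp: x_def)
    qed
  qed
qed


section \<open>Reduced products\<close>

locale ideal_product =
  fixes I :: "'i set" and J :: "'i set set"
    and L :: "('f, 'r) language" and M :: "'i \<Rightarrow> ('f, 'r, 'a) struct"
  assumes ideal: "ideal_on I J" and structures: "\<forall>i\<in>I. is_structure L (M i)"
begin

abbreviation \<F> :: "'i filter" where
  "\<F> \<equiv> dual_filter I J"

abbreviation ProdM :: "('i \<Rightarrow> 'a) set" where
  "ProdM \<equiv> \<Pi>\<^sub>E i\<in>I. universe (M i)"

abbreviation R :: "('f, 'r, ('i \<Rightarrow> 'a) set) struct" where
  "R \<equiv> reduced_product I J M"

definition eval_section :: "(nat \<Rightarrow> 'i \<Rightarrow> 'a) \<Rightarrow> 'f tm \<Rightarrow> 'i \<Rightarrow> 'a" where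
  "eval_section E t = (\<lambda>i\<in>I. eval_tm (M i) (\<lambda>v. E v i) t)"

definition cls :: "('i \<Rightarrow> 'a) \<Rightarrow> ('i \<Rightarrow> 'a) set" where
  "cls a = red_rel I J M `` {a}"

lemmas eventually_mem = eventually_dual_filter_mem[OF ideal]

lemma universe_nonempty: "i \<in> I \<Longrightarrow> universe (M i) \<noteq> {}"
  using structures by (simp add: is_structure_def)

lemma universe_R: "universe R = cls ` ProdM"
  by (auto simp: reduced_product_def quotient_def cls_def)

lemma cls_in_universe: "a \<in> ProdM \<Longrightarrow> cls a \<in> universe R"
  by (simp add: universe_R)

lemma range_cls: "range E \<subseteq> ProdM \<Longrightarrow> range (cls \<circ> E) \<subseteq> universe R"
  by (auto simp: universe_R)

lemma cls_eq_iff: "a \<in> ProdM \<Longrightarrow> b \<in> ProdM \<Longrightarrow> cls a = cls b \<longleftrightarrow> (\<forall>\<^sub>F i in \<F>. a i = b i)"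
  unfolding cls_def eventually_dual_filter[OF ideal]
  by (subst eq_equiv_class_iff[OF equiv_red_rel[OF ideal]]) (auto simp: red_rel_def)

lemma range_component:
  assumes "range E \<subseteq> ProdM" "i \<in> I"
  shows "range (\<lambda>v. E v i) \<subseteq> universe (M i)"
  using assms by (auto simp: image_subset_iff)

lemma lift_assignment:
  assumes "range e \<subseteq> universe R"
  obtains E where "range E \<subseteq> ProdM" "e = cls \<circ> E"
proof -
  have "\<forall>v. \<exists>a. a \<in> ProdM \<and> e v = cls a"
    using assms unfolding universe_R by blast
  then obtain E where "\<forall>v. E v \<in> ProdM \<and> e v = cls (E v)"
    unfolding choice_iff by blast
  then show thesis
    by (intro that[of E]) auto
qed

lemma eval_section_in_ProdM:
  assumes "range E \<subseteq> ProdM" "wf_tm L t"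
  shows "eval_section E t \<in> ProdM"
  using eval_tm_in_universe[OF structures[rule_format] range_component[OF assms(1)] assms(2)]
  by (simp add: eval_section_def)

lemma map_eval_section_in_lists:
  assumes "range E \<subseteq> ProdM" "\<forall>t\<in>set ts. wf_tm L t"
  shows "map (eval_section E) ts \<in> lists ProdM"
  unfolding in_lists_conv_set set_map using eval_section_in_ProdM assms by blast

lemma fun_interp_in_ProdM:
  assumes "f \<in> funs L" "length as = fun_arity L f" "as \<in> lists ProdM"
  shows "(\<lambda>i\<in>I. fun_interp (M i) f (map (\<lambda>a. a i) as)) \<in> ProdM"
proof -
  have "fun_interp (M i) f (map (\<lambda>a. a i) as) \<in> universe (M i)" if i: "i \<in> I" for i
  proof -
    have "map (\<lambda>a. a i) as \<in> lists (universe (M i))"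
      using assms(3) PiE_mem[of _ I "\<lambda>i. universe (M i)", OF _ i] by auto
    then show ?thesis
      using structures i assms(1,2) unfolding is_structure_def by simp
  qed
  then show ?thesis by simp
qed

lemma is_structure_R: "is_structure L R"
  unfolding is_structure_def
proof (intro conjI ballI impI)
  show "universe R \<noteq> {}"
    using universe_nonempty by (simp add: universe_R PiE_eq_empty_iff)
  fix f cs assume f: "f \<in> funs L" and cs: "cs \<in> lists (universe R)" "length cs = fun_arity L f"
  obtain as where as: "as \<in> lists ProdM" "cs = map cls as"
    using cs(1) unfolding universe_R lists_image by blast
  then have "length as = fun_arity L f"
    using cs(2) by simp
  then have "fun_interp R f cs = cls (\<lambda>i\<in>I. fun_interp (M i) f (map (\<lambda>a. a i) as))"
    unfolding as(2) by (rule fun_interp_reduced_product[OF ideal structures f _ as(1), folded cls_def])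
  then show "fun_interp R f cs \<in> universe R"
    using fun_interp_in_ProdM[OF f \<open>length as = _\<close> as(1)] by (simp add: cls_in_universe)
qed

lemma eval_tm_R:
  assumes E: "range E \<subseteq> ProdM" and "wf_tm L t"
  shows "eval_tm R (cls \<circ> E) t = cls (eval_section E t)"
  using assms(2)
proof (induction t)
  case (Var n)
  have "(\<lambda>i\<in>I. E n i) = E n"
    using E by (intro PiE_restrict) blast
  then show ?case by (simp add: eval_section_def)
next
  case (App f ts)
  let ?as = "map (eval_section E) ts"
  have f: "f \<in> funs L" "length ?as = fun_arity L f"
    using App.prems by auto
  have as: "?as \<in> lists ProdM"
    using App.prems by (intro map_eval_section_in_lists[OF E]) simp
  have "map (eval_tm R (cls \<circ> E)) ts = map cls ?as"
    using App by (simp add: comp_def)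
  then have "eval_tm R (cls \<circ> E) (App f ts) = cls (\<lambda>i\<in>I. fun_interp (M i) f (map (\<lambda>a. a i) ?as))"
    using fun_interp_reduced_product[OF ideal structures f as, folded cls_def]
    by (simp only: eval_tm.simps)
  also have "(\<lambda>i\<in>I. fun_interp (M i) f (map (\<lambda>a. a i) ?as)) = eval_section E (App f ts)"
    by (simp add: eval_section_def comp_def cong: restrict_cong)
  finally show ?case .
qed

lemma ex_ProdM_eventually_iff:
  "(\<exists>a\<in>ProdM. \<forall>\<^sub>F i in \<F>. P i (a i)) \<longleftrightarrow> (\<forall>\<^sub>F i in \<F>. \<exists>u\<in>universe (M i). P i u)"
proof
  assume "\<exists>a\<in>ProdM. \<forall>\<^sub>F i in \<F>. P i (a i)"
  then obtain a where "a \<in> ProdM" "\<forall>\<^sub>F i in \<F>. P i (a i)" by blast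
  from this(2) eventually_mem show "\<forall>\<^sub>F i in \<F>. \<exists>u\<in>universe (M i). P i u"
    by eventually_elim (use PiE_mem[OF \<open>a \<in> ProdM\<close>] in blast)
next
  assume *: "\<forall>\<^sub>F i in \<F>. \<exists>u\<in>universe (M i). P i u"
  have "\<forall>i\<in>I. \<exists>u\<in>universe (M i). (\<exists>v\<in>universe (M i). P i v) \<longrightarrow> P i u"
    using universe_nonempty by blast
  then obtain a where a: "a \<in> ProdM" "\<forall>i\<in>I. (\<exists>v\<in>universe (M i). P i v) \<longrightarrow> P i (a i)"
    by (rule PiE_choice)
  from * eventually_mem have "\<forall>\<^sub>F i in \<F>. P i (a i)"
    by eventually_elim (use a(2) in blast)
  with a(1) show "\<exists>a\<in>ProdM. \<forall>\<^sub>F i in \<F>. P i (a i)"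
    by blast
qed

lemma ball_ProdM_eventually_iff:
  assumes "\<forall>\<^sub>F i in \<F>. \<exists>u\<in>universe (M i). P i u"
  shows "(\<forall>a\<in>ProdM. (\<forall>\<^sub>F i in \<F>. P i (a i)) \<longrightarrow> (\<forall>\<^sub>F i in \<F>. Q i (a i))) \<longleftrightarrow>
    (\<forall>\<^sub>F i in \<F>. \<forall>u\<in>universe (M i). P i u \<longrightarrow> Q i u)"
proof
  assume all: "\<forall>a\<in>ProdM. (\<forall>\<^sub>F i in \<F>. P i (a i)) \<longrightarrow> (\<forall>\<^sub>F i in \<F>. Q i (a i))"
  have "\<forall>i\<in>I. \<exists>u\<in>universe (M i). ((\<exists>v\<in>universe (M i). P i v) \<longrightarrow> P i u) \<and>
      ((\<exists>v\<in>universe (M i). P i v \<and> \<not> Q i v) \<longrightarrow> \<not> Q i u)"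
    using universe_nonempty by blast
  then obtain a where a: "a \<in> ProdM" "\<forall>i\<in>I. ((\<exists>v\<in>universe (M i). P i v) \<longrightarrow> P i (a i)) \<and>
      ((\<exists>v\<in>universe (M i). P i v \<and> \<not> Q i v) \<longrightarrow> \<not> Q i (a i))"
    by (rule PiE_choice)
  from assms eventually_mem have "\<forall>\<^sub>F i in \<F>. P i (a i)"
    by eventually_elim (use a(2) in blast)
  then have "\<forall>\<^sub>F i in \<F>. Q i (a i)"
    using all a(1) by blast
  then show "\<forall>\<^sub>F i in \<F>. \<forall>u\<in>universe (M i). P i u \<longrightarrow> Q i u"
    using eventually_mem by eventually_elim (use a(2) in blast)
next
  assume all: "\<forall>\<^sub>F i in \<F>. \<forall>u\<in>universe (M i). P i u \<longrightarrow> Q i u"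
  show "\<forall>a\<in>ProdM. (\<forall>\<^sub>F i in \<F>. P i (a i)) \<longrightarrow> (\<forall>\<^sub>F i in \<F>. Q i (a i))"
  proof (intro ballI impI)
    fix a assume a: "a \<in> ProdM" "\<forall>\<^sub>F i in \<F>. P i (a i)"
    from all a(2) eventually_mem show "\<forall>\<^sub>F i in \<F>. Q i (a i)"
      by eventually_elim (use PiE_mem[OF a(1)] in blast)
  qed
qed


subsection \<open>Horn formulas\<close>

text \<open>
  The formulas for which the theorem of Los holds modulo \<open>J\<close>. Besides \<open>\<and>\<close> and \<open>\<exists>\<close>, they are closed
  under the connective \<open>\<exists>x p \<and> \<forall>x (p \<longrightarrow> q)\<close> of Palyutin's h-formulas.
\<close>

definition horn :: "('f, 'r) fm \<Rightarrow> bool" where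
  "horn p \<longleftrightarrow> wf_fm L p \<and>
    (\<forall>E. range E \<subseteq> ProdM \<longrightarrow> (sat R (cls \<circ> E) p \<longleftrightarrow> (\<forall>\<^sub>F i in \<F>. sat (M i) (\<lambda>v. E v i) p)))"

definition guard :: "nat \<Rightarrow> ('f, 'r) fm \<Rightarrow> ('f, 'r) fm \<Rightarrow> ('f, 'r) fm" where
  "guard n p q = Conj (Exists n p) (Neg (Exists n (Conj p (Neg q))))"

lemma hornI:
  assumes "wf_fm L p"
    and "\<And>E. range E \<subseteq> ProdM \<Longrightarrow> sat R (cls \<circ> E) p \<longleftrightarrow> (\<forall>\<^sub>F i in \<F>. sat (M i) (\<lambda>v. E v i) p)"
  shows "horn p"
  using assms by (simp add: horn_def)

lemma wf_fm_horn: "horn p \<Longrightarrow> wf_fm L p"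
  by (simp add: horn_def)

lemma sat_horn:
  "horn p \<Longrightarrow> range E \<subseteq> ProdM \<Longrightarrow> sat R (cls \<circ> E) p \<longleftrightarrow> (\<forall>\<^sub>F i in \<F>. sat (M i) (\<lambda>v. E v i) p)"
  by (simp add: horn_def)

lemma sat_horn_upd:
  assumes "horn p" "range E \<subseteq> ProdM" "a \<in> ProdM"
  shows "sat R ((cls \<circ> E)(n := cls a)) p \<longleftrightarrow> (\<forall>\<^sub>F i in \<F>. sat (M i) ((\<lambda>v. E v i)(n := a i)) p)"
proof -
  have "range (E(n := a)) \<subseteq> ProdM"
    using assms(2,3) by auto
  moreover have "(\<lambda>v. (E(n := a)) v i) = (\<lambda>v. E v i)(n := a i)" for i
    by auto
  ultimately show ?thesis
    using sat_horn[OF assms(1), of "E(n := a)"] by (simp add: fun_upd_comp)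
qed

lemma horn_Eql:
  assumes "wf_tm L s" "wf_tm L t"
  shows "horn (Eql s t)"
proof (rule hornI)
  fix E :: "nat \<Rightarrow> 'i \<Rightarrow> 'a" assume E: "range E \<subseteq> ProdM"
  have "sat R (cls \<circ> E) (Eql s t) \<longleftrightarrow> (\<forall>\<^sub>F i in \<F>. eval_section E s i = eval_section E t i)"
    using eval_tm_R[OF E] eval_section_in_ProdM[OF E] assms by (simp add: cls_eq_iff)
  also have "\<dots> \<longleftrightarrow> (\<forall>\<^sub>F i in \<F>. sat (M i) (\<lambda>v. E v i) (Eql s t))"
    using eventually_mem
    by (intro eventually_subst) (auto simp: eval_section_def elim: eventually_mono)
  finally show "sat R (cls \<circ> E) (Eql s t) \<longleftrightarrow> (\<forall>\<^sub>F i in \<F>. sat (M i) (\<lambda>v. E v i) (Eql s t))" .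
qed (use assms in simp)

lemma horn_Rel:
  assumes "wf_fm L (Rel r ts)"
  shows "horn (Rel r ts)"
proof (rule hornI)
  fix E :: "nat \<Rightarrow> 'i \<Rightarrow> 'a" assume E: "range E \<subseteq> ProdM"
  let ?as = "map (eval_section E) ts"
  have "?as \<in> lists ProdM"
    using assms by (intro map_eval_section_in_lists[OF E]) simp
  moreover have "map (eval_tm R (cls \<circ> E)) ts = map cls ?as"
    using assms eval_tm_R[OF E] by (simp add: comp_def)
  ultimately have "sat R (cls \<circ> E) (Rel r ts) \<longleftrightarrow> (\<forall>\<^sub>F i in \<F>. rel_interp (M i) r (map (\<lambda>a. a i) ?as))"
    using rel_interp_reduced_product[OF ideal, where M = M, folded cls_def]
    by (simp only: sat.simps eventually_dual_filter[OF ideal])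
  also have "\<dots> \<longleftrightarrow> (\<forall>\<^sub>F i in \<F>. sat (M i) (\<lambda>v. E v i) (Rel r ts))"
    using eventually_mem
    by (intro eventually_subst) (auto simp: eval_section_def comp_def elim: eventually_mono)
  finally show "sat R (cls \<circ> E) (Rel r ts) \<longleftrightarrow> (\<forall>\<^sub>F i in \<F>. sat (M i) (\<lambda>v. E v i) (Rel r ts))" .
qed (rule assms)

lemma horn_Conj: "horn p \<Longrightarrow> horn q \<Longrightarrow> horn (Conj p q)"
  by (rule hornI) (simp_all add: wf_fm_horn sat_horn eventually_conj_iff)

lemma horn_Exists:
  assumes p: "horn p"
  shows "horn (Exists n p)"
proof (rule hornI)
  fix E :: "nat \<Rightarrow> 'i \<Rightarrow> 'a" assume E: "range E \<subseteq> ProdM"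
  show "sat R (cls \<circ> E) (Exists n p) \<longleftrightarrow> (\<forall>\<^sub>F i in \<F>. sat (M i) (\<lambda>v. E v i) (Exists n p))"
    using ex_ProdM_eventually_iff[of "\<lambda>i u. sat (M i) ((\<lambda>v. E v i)(n := u)) p"]
    by (simp add: universe_R sat_horn_upd[OF p E])
qed (use p in \<open>simp add: wf_fm_horn\<close>)

lemma horn_guard:
  assumes p: "horn p" and q: "horn q"
  shows "horn (guard n p q)"
proof (rule hornI)
  fix E :: "nat \<Rightarrow> 'i \<Rightarrow> 'a" assume E: "range E \<subseteq> ProdM"
  let ?P = "\<lambda>p i u. sat (M i) ((\<lambda>v. E v i)(n := u)) p"
  have "sat R (cls \<circ> E) (guard n p q) \<longleftrightarrow> (\<exists>a\<in>ProdM. \<forall>\<^sub>F i in \<F>. ?P p i (a i)) \<and>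
      (\<forall>a\<in>ProdM. (\<forall>\<^sub>F i in \<F>. ?P p i (a i)) \<longrightarrow> (\<forall>\<^sub>F i in \<F>. ?P q i (a i)))"
    using sat_horn_upd[OF p E] sat_horn_upd[OF q E] by (simp add: universe_R guard_def)
  also have "\<dots> \<longleftrightarrow> (\<forall>\<^sub>F i in \<F>. \<exists>u\<in>universe (M i). ?P p i u) \<and>
      (\<forall>\<^sub>F i in \<F>. \<forall>u\<in>universe (M i). ?P p i u \<longrightarrow> ?P q i u)"
    by (rule conj_cong[OF ex_ProdM_eventually_iff[of "?P p"]
          ball_ProdM_eventually_iff[of "?P p" "?P q"]])
  also have "\<dots> \<longleftrightarrow> (\<forall>\<^sub>F i in \<F>. sat (M i) (\<lambda>v. E v i) (guard n p q))"
    by (simp add: guard_def eventually_conj_iff)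
  finally show "sat R (cls \<circ> E) (guard n p q) \<longleftrightarrow> (\<forall>\<^sub>F i in \<F>. sat (M i) (\<lambda>v. E v i) (guard n p q))" .
qed (use p q in \<open>simp add: wf_fm_horn guard_def\<close>)

lemma horn_finite_conj:
  assumes "finite H" "H \<subseteq> Collect horn"
  obtains c where "horn c" "\<And>e. sat R e c \<longleftrightarrow> (\<forall>q\<in>H. sat R e q)"
proof -
  have "\<exists>c. horn c \<and> (\<forall>e. sat R e c \<longleftrightarrow> (\<forall>q\<in>H. sat R e q))"
    using assms
  proof (induction H)
    case empty
    show ?case
      by (rule exI[of _ "Eql (Var 0) (Var 0)"]) (simp add: horn_Eql)
  next
    case (insert q H)
    then obtain c where "horn c" "\<forall>e. sat R e c \<longleftrightarrow> (\<forall>q\<in>H. sat R e q)"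
      by auto
    then show ?case
      using insert.prems by (intro exI[of _ "Conj q c"]) (simp add: horn_Conj)
  qed
  then show thesis
    using that by blast
qed

text \<open>
  As a finite \<open>H\<close> has only finitely many assignments of truth values, such a \<open>P\<close> is a Boolean
  combination of horn formulas.
\<close>

definition horn_determined :: "((nat \<Rightarrow> ('i \<Rightarrow> 'a) set) \<Rightarrow> bool) \<Rightarrow> bool" where
  "horn_determined P \<longleftrightarrow> (\<exists>H. finite H \<and> H \<subseteq> Collect horn \<and>
    (\<forall>e e'. range e \<subseteq> universe R \<longrightarrow> range e' \<subseteq> universe R \<longrightarrow>
      (\<forall>q\<in>H. sat R e q \<longleftrightarrow> sat R e' q) \<longrightarrow> (P e \<longleftrightarrow> P e')))"

lemma horn_determinedI:
  assumes "finite H" "H \<subseteq> Collect horn"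
    and "\<And>e e'. range e \<subseteq> universe R \<Longrightarrow> range e' \<subseteq> universe R \<Longrightarrow>
      \<forall>q\<in>H. sat R e q \<longleftrightarrow> sat R e' q \<Longrightarrow> P e \<Longrightarrow> P e'"
  shows "horn_determined P"
  unfolding horn_determined_def using assms by (intro exI[of _ H]) blast

lemma horn_determinedE:
  assumes "horn_determined P"
  obtains H where "finite H" "H \<subseteq> Collect horn"
    "\<And>e e'. range e \<subseteq> universe R \<Longrightarrow> range e' \<subseteq> universe R \<Longrightarrow>
      \<forall>q\<in>H. sat R e q \<longleftrightarrow> sat R e' q \<Longrightarrow> P e \<longleftrightarrow> P e'"
  using assms unfolding horn_determined_def by blast

lemma horn_determined_horn: "horn p \<Longrightarrow> horn_determined (\<lambda>e. sat R e p)"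
  by (rule horn_determinedI[of "{p}"]) auto

lemma horn_determined_not: "horn_determined P \<Longrightarrow> horn_determined (\<lambda>e. \<not> P e)"
  unfolding horn_determined_def by simp

lemma horn_determined_conj:
  assumes "horn_determined P" "horn_determined Q"
  shows "horn_determined (\<lambda>e. P e \<and> Q e)"
proof -
  obtain H where H: "finite H" "H \<subseteq> Collect horn"
    "\<And>e e'. range e \<subseteq> universe R \<Longrightarrow> range e' \<subseteq> universe R \<Longrightarrow>
      \<forall>q\<in>H. sat R e q \<longleftrightarrow> sat R e' q \<Longrightarrow> P e \<longleftrightarrow> P e'"
    by (rule horn_determinedE[OF assms(1)]) (rule that)
  obtain H' where H': "finite H'" "H' \<subseteq> Collect horn"
    "\<And>e e'. range e \<subseteq> universe R \<Longrightarrow> range e' \<subseteq> universe R \<Longrightarrow>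
      \<forall>q\<in>H'. sat R e q \<longleftrightarrow> sat R e' q \<Longrightarrow> Q e \<longleftrightarrow> Q e'"
    by (rule horn_determinedE[OF assms(2)]) (rule that)
  show ?thesis
  proof (rule horn_determinedI)
    show "finite (H \<union> H')" "H \<union> H' \<subseteq> Collect horn"
      using H(1,2) H'(1,2) by auto
    fix e e' assume "range e \<subseteq> universe R" "range e' \<subseteq> universe R" "\<forall>q\<in>H \<union> H'. sat R e q \<longleftrightarrow> sat R e' q"
    then show "P e \<and> Q e \<Longrightarrow> P e' \<and> Q e'"
      using H(3)[of e e'] H'(3)[of e e'] by blast
  qed
qed

lemma cls_in_defset_horn_iff:
  assumes "horn p" "range E \<subseteq> ProdM" "a \<in> ProdM"
  shows "cls a \<in> defset R p (cls \<circ> E) \<longleftrightarrow> (\<forall>\<^sub>F i in \<F>. a i \<in> defset (M i) p (\<lambda>v. E v i))"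
proof -
  have "\<forall>\<^sub>F i in \<F>. a i \<in> universe (M i)"
    using eventually_mem by eventually_elim (rule PiE_mem[OF assms(3)])
  then show ?thesis
    by (simp add: defset_def cls_in_universe sat_horn_upd assms eventually_conj_iff)
qed

lemma eventually_linked_if_linked_cls:
  assumes p: "horn p" and a: "a \<in> ProdM" and b: "b \<in> ProdM" and linked: "linked R p (cls a) (cls b)"
  shows "\<forall>\<^sub>F i in \<F>. linked (M i) p (a i) (b i)"
proof -
  from linked obtain e where e: "range e \<subseteq> universe R" "cls a \<in> defset R p e" "cls b \<in> defset R p e"
    unfolding linked_def by blast
  obtain E where E: "range E \<subseteq> ProdM" "e = cls \<circ> E"
    by (rule lift_assignment[OF e(1)])
  from e have "\<forall>\<^sub>F i in \<F>. a i \<in> defset (M i) p (\<lambda>v. E v i)"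
      "\<forall>\<^sub>F i in \<F>. b i \<in> defset (M i) p (\<lambda>v. E v i)"
    unfolding E(2) using cls_in_defset_horn_iff[OF p E(1)] a b by simp_all
  with eventually_mem show ?thesis
    by eventually_elim (rule linkedI[OF range_component[OF E(1)]])
qed

lemma linked_cls_if_eventually_linked:
  assumes p: "horn p" and a: "a \<in> ProdM" and b: "b \<in> ProdM"
    and linked: "\<forall>\<^sub>F i in \<F>. linked (M i) p (a i) (b i)"
  shows "linked R p (cls a) (cls b)"
proof -
  have "\<exists>e. range e \<subseteq> universe (M i) \<and>
      (linked (M i) p (a i) (b i) \<longrightarrow> a i \<in> defset (M i) p e \<and> b i \<in> defset (M i) p e)"
    if "i \<in> I" for i
  proof (cases "linked (M i) p (a i) (b i)")
    case True
    then show ?thesis unfolding linked_def by blast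
  next
    case False
    then show ?thesis
      using PiE_mem[OF a that] by (intro exI[of _ "\<lambda>_. a i"]) auto
  qed
  then obtain \<epsilon> where \<epsilon>: "\<And>i. i \<in> I \<Longrightarrow> range (\<epsilon> i) \<subseteq> universe (M i) \<and>
      (linked (M i) p (a i) (b i) \<longrightarrow> a i \<in> defset (M i) p (\<epsilon> i) \<and> b i \<in> defset (M i) p (\<epsilon> i))"
    by metis
  define E where "E v = (\<lambda>i\<in>I. \<epsilon> i v)" for v
  have E: "range E \<subseteq> ProdM"
    using \<epsilon> by (auto simp: E_def image_subset_iff)
  have "\<forall>\<^sub>F i in \<F>. a i \<in> defset (M i) p (\<lambda>v. E v i) \<and> b i \<in> defset (M i) p (\<lambda>v. E v i)"
    using linked eventually_mem by eventually_elim (use \<epsilon> in \<open>simp add: E_def\<close>)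
  then have "cls a \<in> defset R p (cls \<circ> E)" "cls b \<in> defset R p (cls \<circ> E)"
    using cls_in_defset_horn_iff[OF p E] a b by (simp_all add: eventually_conj_iff)
  then show ?thesis
    by (rule linkedI[OF range_cls[OF E]])
qed

lemma linked_cls_iff:
  assumes "horn p" "a \<in> ProdM" "b \<in> ProdM"
  shows "linked R p (cls a) (cls b) \<longleftrightarrow> (\<forall>\<^sub>F i in \<F>. linked (M i) p (a i) (b i))"
  using eventually_linked_if_linked_cls linked_cls_if_eventually_linked assms by blast

abbreviation horn_sets :: "('i \<Rightarrow> 'a) set set \<Rightarrow> ('i \<Rightarrow> 'a) set set set" where
  "horn_sets A \<equiv> defsets R (Collect horn) A"

lemma universe_in_horn_sets:
  assumes "A \<noteq> {}"
  shows "universe R \<in> horn_sets A"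
proof -
  obtain a where "a \<in> A" using assms by blast
  have "universe R = defset R (Eql (Var 0) (Var 0)) (\<lambda>_. a)"
    by (simp add: defset_def)
  also have "\<dots> \<in> horn_sets A"
    using \<open>a \<in> A\<close> by (intro defsetsI) (auto simp: horn_Eql)
  finally show ?thesis .
qed

lemma internal_horn_set:
  assumes "S \<in> horn_sets (universe R)"
  shows "\<exists>B. \<forall>a\<in>ProdM. cls a \<in> S \<longleftrightarrow> (\<forall>\<^sub>F i in \<F>. a i \<in> B i)"
proof -
  obtain p e where p: "horn p" and e: "range e \<subseteq> universe R" and S: "S = defset R p e"
    using assms unfolding defsets_def by blast
  obtain E where "range E \<subseteq> ProdM" "e = cls \<circ> E"
    by (rule lift_assignment[OF e])
  then show ?thesis
    using cls_in_defset_horn_iff[OF p] S by (intro exI[of _ "\<lambda>i. defset (M i) p (\<lambda>v. E v i)"]) simp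
qed

lemma horn_sets_internal_sequence:
  assumes \<X>: "countable \<X>" "\<X> \<noteq> {}" "\<X> \<subseteq> horn_sets (universe R)"
  obtains Q Y where "\<And>n. finite (Q n)" "(\<Union>n. Q n) = \<X>"
    "\<And>i. Y 0 i = universe (M i)" "\<And>i. decseq (\<lambda>n. Y n i)"
    "\<forall>n. \<forall>a\<in>ProdM. cls a \<in> \<Inter>(Q n) \<longleftrightarrow> (\<forall>\<^sub>F i in \<F>. a i \<in> Y n i)"
proof -
  have "\<forall>S\<in>\<X>. \<exists>B. \<forall>a\<in>ProdM. cls a \<in> S \<longleftrightarrow> (\<forall>\<^sub>F i in \<F>. a i \<in> B i)"
    using \<X>(3) internal_horn_set by blast
  then obtain B where B: "\<forall>S\<in>\<X>. \<forall>a\<in>ProdM. cls a \<in> S \<longleftrightarrow> (\<forall>\<^sub>F i in \<F>. a i \<in> B S i)"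
    unfolding bchoice_iff by blast
  define Q where "Q n = from_nat_into \<X> ` {..<n}" for n
  define Y where "Y n i = universe (M i) \<inter> (\<Inter>S\<in>Q n. B S i)" for n i
  have "(\<Union>n. Q n) = range (from_nat_into \<X>)"
    by (auto simp: Q_def)
  then have Q_\<X>: "(\<Union>n. Q n) = \<X>"
    using range_from_nat_into[OF \<X>(2,1)] by simp
  show thesis
  proof (rule that)
    show finite: "finite (Q n)" for n
      by (simp add: Q_def)
    show "(\<Union>n. Q n) = \<X>" by (fact Q_\<X>)
    show "Y 0 i = universe (M i)" for i
      by (simp add: Y_def Q_def)
    show "decseq (\<lambda>n. Y n i)" for i
      by (rule decseq_SucI) (auto simp: Y_def Q_def lessThan_Suc)
    show "\<forall>n. \<forall>a\<in>ProdM. cls a \<in> \<Inter>(Q n) \<longleftrightarrow> (\<forall>\<^sub>F i in \<F>. a i \<in> Y n i)"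
    proof (intro allI ballI)
      fix n a assume a: "a \<in> ProdM"
      have "\<forall>\<^sub>F i in \<F>. a i \<in> universe (M i)"
        using eventually_mem by eventually_elim (rule PiE_mem[OF a])
      moreover have "Q n \<subseteq> \<X>"
        using Q_\<X> by blast
      then have "cls a \<in> \<Inter>(Q n) \<longleftrightarrow> (\<forall>S\<in>Q n. \<forall>\<^sub>F i in \<F>. a i \<in> B S i)"
        using B a by (simp add: subset_iff)
      ultimately show "cls a \<in> \<Inter>(Q n) \<longleftrightarrow> (\<forall>\<^sub>F i in \<F>. a i \<in> Y n i)"
        by (simp add: Y_def eventually_conj_iff eventually_ball_finite_distrib finite)
    qed
  qed
qed

end


subsection \<open>Products modulo a layered ideal\<close>

locale layered_product = ideal_product I J L M
  for I :: "'i set" and J :: "'i set set"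
    and L :: "('f, 'r) language" and M :: "'i \<Rightarrow> ('f, 'r, 'a) struct" +
  assumes layered: "layered I J"
begin

lemma horn_witness:
  assumes c: "horn c" and H: "countable H" "H \<subseteq> Collect horn" and e: "range e \<subseteq> universe R"
    and ex: "sat R e (Exists n c)" and not_guard: "\<forall>q\<in>H. \<not> sat R e (guard n c q)"
  obtains a where "a \<in> universe R" "sat R (e(n := a)) c" "\<forall>q\<in>H. \<not> sat R (e(n := a)) q"
proof -
  obtain E where E: "range E \<subseteq> ProdM" "e = cls \<circ> E"
    by (rule lift_assignment[OF e])
  let ?P = "\<lambda>p i u. sat (M i) ((\<lambda>v. E v i)(n := u)) p"
  have P: "\<forall>\<^sub>F i in \<F>. \<exists>u\<in>universe (M i). ?P c i u"
    using ex sat_horn[OF horn_Exists[OF c] E(1)] by (simp add: E(2))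
  have Q: "\<forall>q\<in>H. \<exists>\<^sub>F i in \<F>. \<exists>u\<in>universe (M i). ?P c i u \<and> \<not> ?P q i u"
  proof
    fix q assume "q \<in> H"
    then have "\<not> (\<forall>\<^sub>F i in \<F>. sat (M i) (\<lambda>v. E v i) (guard n c q))"
      using not_guard H(2) sat_horn[OF horn_guard[OF c, of q] E(1)] by (auto simp: E(2))
    with P show "\<exists>\<^sub>F i in \<F>. \<exists>u\<in>universe (M i). ?P c i u \<and> \<not> ?P q i u"
      by (simp add: guard_def eventually_conj_iff not_eventually)
  qed
  obtain a where a: "a \<in> ProdM" "\<forall>\<^sub>F i in \<F>. ?P c i (a i)" "\<forall>q\<in>H. \<exists>\<^sub>F i in \<F>. \<not> ?P q i (a i)"
    by (rule layered_selection[OF layered H(1) universe_nonempty P Q])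
  show thesis
  proof (rule that)
    show "cls a \<in> universe R" "sat R (e(n := cls a)) c"
      using a(1,2) sat_horn_upd[OF c E(1) a(1)] by (simp_all add: cls_in_universe E(2))
    show "\<forall>q\<in>H. \<not> sat R (e(n := cls a)) q"
      using a(3) H(2) sat_horn_upd[OF _ E(1) a(1)] by (auto simp: E(2) frequently_def)
  qed
qed

lemma horn_transfer:
  assumes c: "horn c" and H: "countable H" "H \<subseteq> Collect horn" and e': "range e' \<subseteq> universe R"
    and a: "a \<in> universe R" "sat R (e(n := a)) c" "\<forall>q\<in>H. \<not> sat R (e(n := a)) q"
    and agree: "sat R e (Exists n c) \<longleftrightarrow> sat R e' (Exists n c)"
      "\<forall>q\<in>H. sat R e (guard n c q) \<longleftrightarrow> sat R e' (guard n c q)"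
  obtains a' where "a' \<in> universe R" "sat R (e'(n := a')) c" "\<forall>q\<in>H. \<not> sat R (e'(n := a')) q"
proof -
  have "sat R e (Exists n c)" "\<forall>q\<in>H. \<not> sat R e (guard n c q)"
    using a by (auto simp: guard_def)
  with agree have "sat R e' (Exists n c)" "\<forall>q\<in>H. \<not> sat R e' (guard n c q)"
    by simp_all
  then show thesis
    by (rule horn_witness[OF c H e']) (rule that)
qed

lemma horn_back_and_forth:
  assumes H: "finite H" "H \<subseteq> Collect horn"
  obtains H' where "finite H'" "H' \<subseteq> Collect horn"
    "\<And>e e' a. range e' \<subseteq> universe R \<Longrightarrow> \<forall>q\<in>H'. sat R e q \<longleftrightarrow> sat R e' q \<Longrightarrow> a \<in> universe R \<Longrightarrow>
      \<exists>a'\<in>universe R. \<forall>q\<in>H. sat R (e(n := a)) q \<longleftrightarrow> sat R (e'(n := a')) q"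
proof -
  have "\<exists>c. horn c \<and> (\<forall>e. sat R e c \<longleftrightarrow> (\<forall>q\<in>T. sat R e q))" if "T \<in> Pow H" for T
    by (rule horn_finite_conj[of T]) (use that H finite_subset in auto)
  then obtain c where c: "\<And>T. T \<in> Pow H \<Longrightarrow> horn (c T) \<and> (\<forall>e. sat R e (c T) \<longleftrightarrow> (\<forall>q\<in>T. sat R e q))"
    by metis
  let ?H' = "(\<lambda>T. Exists n (c T)) ` Pow H \<union> (\<lambda>(T, q). guard n (c T) q) ` (Pow H \<times> H)"
  show thesis
  proof (rule that)
    show "finite ?H'"
      using H(1) by simp
    show "?H' \<subseteq> Collect horn"
      using H(2) c by (auto intro: horn_Exists horn_guard)
    fix e e' a assume e': "range e' \<subseteq> universe R" and agree: "\<forall>q\<in>?H'. sat R e q \<longleftrightarrow> sat R e' q"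
      and a: "a \<in> universe R"
    define T where "T = {q \<in> H. sat R (e(n := a)) q}"
    have T: "T \<in> Pow H" by (auto simp: T_def)
    have T_true: "sat R (e(n := a)) (c T)" and HT_false: "\<forall>q\<in>H - T. \<not> sat R (e(n := a)) q"
      using c[OF T] by (auto simp: T_def)
    have agree_Exists: "sat R e (Exists n (c T)) \<longleftrightarrow> sat R e' (Exists n (c T))"
      by (rule bspec[OF agree]) (use T in blast)
    have agree_guard: "\<forall>q\<in>H - T. sat R e (guard n (c T) q) \<longleftrightarrow> sat R e' (guard n (c T) q)"
      by (intro ballI bspec[OF agree]) (use T in force)
    have HT: "countable (H - T)" "H - T \<subseteq> Collect horn"
      using H by (auto intro: countable_finite)
    obtain a' where a': "a' \<in> universe R" "sat R (e'(n := a')) (c T)"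
        "\<forall>q\<in>H - T. \<not> sat R (e'(n := a')) q"
      by (rule horn_transfer[OF _ HT e' a T_true HT_false agree_Exists agree_guard])
        (use c[OF T] in blast)+
    then have "\<forall>q\<in>H. sat R (e(n := a)) q \<longleftrightarrow> sat R (e'(n := a')) q"
      using c[OF T] by (auto simp: T_def)
    with a'(1) show "\<exists>a'\<in>universe R. \<forall>q\<in>H. sat R (e(n := a)) q \<longleftrightarrow> sat R (e'(n := a')) q"
      by blast
  qed
qed

lemma horn_determined_Exists:
  assumes "horn_determined P"
  shows "horn_determined (\<lambda>e. \<exists>a\<in>universe R. P (e(n := a)))"
proof -
  obtain H where H: "finite H" "H \<subseteq> Collect horn"
    and P: "\<And>e e'. range e \<subseteq> universe R \<Longrightarrow> range e' \<subseteq> universe R \<Longrightarrow>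
      \<forall>q\<in>H. sat R e q \<longleftrightarrow> sat R e' q \<Longrightarrow> P e \<longleftrightarrow> P e'"
    by (rule horn_determinedE[OF assms]) (rule that)
  obtain H' where H': "finite H'" "H' \<subseteq> Collect horn"
    and extend: "\<And>e e' a. range e' \<subseteq> universe R \<Longrightarrow> \<forall>q\<in>H'. sat R e q \<longleftrightarrow> sat R e' q \<Longrightarrow> a \<in> universe R \<Longrightarrow>
      \<exists>a'\<in>universe R. \<forall>q\<in>H. sat R (e(n := a)) q \<longleftrightarrow> sat R (e'(n := a')) q"
    by (rule horn_back_and_forth[OF H]) (rule that)
  show ?thesis
  proof (rule horn_determinedI[OF H'])
    fix e e' assume e: "range e \<subseteq> universe R" "range e' \<subseteq> universe R"
      and agree: "\<forall>q\<in>H'. sat R e q \<longleftrightarrow> sat R e' q"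
    assume "\<exists>a\<in>universe R. P (e(n := a))"
    then obtain a where a: "a \<in> universe R" "P (e(n := a))" by blast
    obtain a' where a': "a' \<in> universe R" "\<forall>q\<in>H. sat R (e(n := a)) q \<longleftrightarrow> sat R (e'(n := a')) q"
      using extend[OF e(2) agree a(1)] by blast
    have "range (e(n := a)) \<subseteq> universe R" "range (e'(n := a')) \<subseteq> universe R"
      using e a(1) a'(1) by auto
    then have "P (e'(n := a'))"
      using P a(2) a'(2) by blast
    with a'(1) show "\<exists>a\<in>universe R. P (e'(n := a))" by blast
  qed
qed

lemma horn_determined_sat: "wf_fm L p \<Longrightarrow> horn_determined (\<lambda>e. sat R e p)"
proof (induction p)
  case (Eql s t)
  then show ?case by (intro horn_determined_horn horn_Eql) auto
next
  case (Rel r ts)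
  then show ?case by (intro horn_determined_horn horn_Rel)
next
  case (Neg p)
  then show ?case by (simp add: horn_determined_not)
next
  case (Conj p q)
  then show ?case by (simp add: horn_determined_conj)
next
  case (Exists n p)
  then have "horn_determined (\<lambda>e. sat R e p)" by simp
  from horn_determined_Exists[OF this, of n] show ?case by simp
qed

lemma ultra_determined_by_horn:
  assumes G: "ultra_on (universe R) G" and p: "wf_fm L p"
    and c: "c \<in> universe R" and e: "range e \<subseteq> universe R"
    and horn: "\<And>q. horn q \<Longrightarrow> c \<in> defset R q e \<longleftrightarrow> defset R q e \<in> G"
  shows "c \<in> defset R p e \<longleftrightarrow> defset R p e \<in> G"
proof -
  obtain H where H: "finite H" "H \<subseteq> Collect horn"
    and determined: "\<And>e e'. range e \<subseteq> universe R \<Longrightarrow> range e' \<subseteq> universe R \<Longrightarrow>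
      \<forall>q\<in>H. sat R e q \<longleftrightarrow> sat R e' q \<Longrightarrow> sat R e p \<longleftrightarrow> sat R e' p"
    by (rule horn_determinedE[OF horn_determined_sat[OF p]]) (rule that)
  obtain a where a: "a \<in> universe R"
    and a_G: "\<And>q. q \<in> insert p H \<Longrightarrow> a \<in> defset R q e \<longleftrightarrow> defset R q e \<in> G"
    using ultra_on_finite_approx[OF G, of "(\<lambda>q. defset R q e) ` insert p H"] H(1) by auto
  have "\<forall>q\<in>H. sat R (e(0 := a)) q \<longleftrightarrow> sat R (e(0 := c)) q"
    using a_G horn H(2) a c by (auto simp: defset_def)
  moreover have "range (e(0 := a)) \<subseteq> universe R" "range (e(0 := c)) \<subseteq> universe R"
    using e a c by auto
  ultimately have "sat R (e(0 := a)) p \<longleftrightarrow> sat R (e(0 := c)) p"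
    using determined by blast
  then show ?thesis
    using a_G[of p] a c by (simp add: defset_def)
qed

lemma frequently_unlinked_section:
  assumes p: "horn p" and Y: "\<forall>a\<in>ProdM. cls a \<in> S \<longleftrightarrow> (\<forall>\<^sub>F i in \<F>. a i \<in> Y i)"
    and unlinked: "\<exists>c \<in> universe R \<inter> S. \<exists>d \<in> universe R \<inter> S. \<not> linked R p c d"
  shows "\<exists>\<^sub>F i in \<F>. \<exists>u\<in>Y i. \<exists>v\<in>Y i. \<not> linked (M i) p u v"
proof -
  obtain a b where a: "a \<in> ProdM" "cls a \<in> S" and b: "b \<in> ProdM" "cls b \<in> S"
    and "\<not> linked R p (cls a) (cls b)"
    using unlinked unfolding universe_R by blast
  then have "\<exists>\<^sub>F i in \<F>. \<not> linked (M i) p (a i) (b i)"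
    using linked_cls_iff[OF p] by (simp add: frequently_def)
  moreover have "\<forall>\<^sub>F i in \<F>. a i \<in> Y i \<and> b i \<in> Y i"
    using a b Y by (simp add: eventually_conj_iff)
  ultimately have "\<exists>\<^sub>F i in \<F>. \<not> linked (M i) p (a i) (b i) \<and> a i \<in> Y i \<and> b i \<in> Y i"
    by (rule frequently_eventually_frequently)
  then show ?thesis
    by (rule frequently_elim1) blast
qed

lemma horn_sets_continuum_unlinked:
  assumes \<X>: "countable \<X>" "\<X> \<noteq> {}" "\<X> \<subseteq> horn_sets (universe R)"
    and N: "countable N" "N \<subseteq> Collect horn"
    and ne: "\<And>Q. finite Q \<Longrightarrow> Q \<subseteq> \<X> \<Longrightarrow> universe R \<inter> \<Inter>Q \<noteq> {}"
    and unlinked: "\<And>Q p. finite Q \<Longrightarrow> Q \<subseteq> \<X> \<Longrightarrow> p \<in> N \<Longrightarrow>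
      \<exists>c \<in> universe R \<inter> \<Inter>Q. \<exists>d \<in> universe R \<inter> \<Inter>Q. \<not> linked R p c d"
  obtains c :: "nat set \<Rightarrow> ('i \<Rightarrow> 'a) set" where "\<And>f. c f \<in> universe R" "\<And>f S. S \<in> \<X> \<Longrightarrow> c f \<in> S"
    "\<And>f g p. f \<noteq> g \<Longrightarrow> p \<in> N \<Longrightarrow> \<not> linked R p (c f) (c g)"
proof -
  obtain Q Y where Q: "\<And>n. finite (Q n)" "(\<Union>n. Q n) = \<X>"
    and Y0: "\<And>i. Y 0 i = universe (M i)" and dec: "\<And>i. decseq (\<lambda>n. Y n i)"
    and Y: "\<forall>n. \<forall>a\<in>ProdM. cls a \<in> \<Inter>(Q n) \<longleftrightarrow> (\<forall>\<^sub>F i in \<F>. a i \<in> Y n i)"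
    by (rule horn_sets_internal_sequence[OF \<X>]) (rule that)
  have Q_\<X>: "Q n \<subseteq> \<X>" for n
    using Q(2) by blast
  have Y_ne: "\<forall>\<^sub>F i in \<F>. Y n i \<noteq> {}" for n
  proof -
    obtain a where "a \<in> ProdM" "cls a \<in> \<Inter>(Q n)"
      using ne[OF Q(1) Q_\<X>, of n] unfolding universe_R by blast
    then have "\<forall>\<^sub>F i in \<F>. a i \<in> Y n i"
      using Y by blast
    then show ?thesis
      by eventually_elim blast
  qed
  have Y_unlinked: "\<exists>\<^sub>F i in \<F>. \<exists>u\<in>Y n i. \<exists>v\<in>Y n i. \<not> linked (M i) p u v" if p: "p \<in> N" for n p
  proof (rule frequently_unlinked_section)
    show "horn p" using p N(2) by blast
    show "\<forall>a\<in>ProdM. cls a \<in> \<Inter>(Q n) \<longleftrightarrow> (\<forall>\<^sub>F i in \<F>. a i \<in> Y n i)"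
      using Y by blast
  qed (rule unlinked[OF Q(1) Q_\<X> p])
  obtain x :: "nat set \<Rightarrow> 'i \<Rightarrow> 'a" where x: "\<And>f. x f \<in> (\<Pi>\<^sub>E i\<in>I. Y 0 i)"
    and x_Y: "\<And>f n. \<forall>\<^sub>F i in \<F>. x f i \<in> Y n i"
    and x_unlinked: "\<And>f g p. f \<noteq> g \<Longrightarrow> p \<in> N \<Longrightarrow> \<exists>\<^sub>F i in \<F>. \<not> linked (M i) p (x f i) (x g i)"
    by (rule layered_continuum_unrelated[OF layered N(1) _ dec Y_ne Y_unlinked])
      (simp add: Y0 universe_nonempty, assumption, rule that)
  have x_ProdM: "x f \<in> ProdM" for f
    using x[of f] by (simp add: Y0)
  show thesis
  proof (rule that[of "\<lambda>f. cls (x f)"])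
    show "cls (x f) \<in> universe R" for f
      using x_ProdM by (rule cls_in_universe)
    show "cls (x f) \<in> S" if "S \<in> \<X>" for f S
      using that Y x_ProdM x_Y unfolding Q(2)[symmetric] by blast
    show "\<not> linked R p (cls (x f)) (cls (x g))" if "f \<noteq> g" "p \<in> N" for f g p
      using x_unlinked[OF that] linked_cls_iff[OF _ x_ProdM x_ProdM] N(2) that(2)
      by (auto simp: frequently_def)
  qed
qed

text \<open>
  Take disjoint positive sets \<open>S j\<close> on which \<open>d\<close> fails with \<open>e'\<close>. The \<open>j\<close>-th parameter is \<open>e'\<close> on
  \<open>S j\<close> and \<open>e\<close> elsewhere; the \<open>i\<close>-th point is \<open>d\<close> on the \<open>S j\<close> with \<open>j < i\<close> and \<open>c\<close> elsewhere.
\<close>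

lemma horn_order_if_overlap:
  assumes p: "horn p" and e: "range e \<subseteq> universe R" "range e' \<subseteq> universe R"
    and c: "c \<in> defset R p e" "c \<in> defset R p e'" and d: "d \<in> defset R p e" "d \<notin> defset R p e'"
  obtains a b where "range a \<subseteq> universe R" "\<forall>j. range (b j) \<subseteq> universe R"
    "\<forall>i j. sat R ((b j)(0 := a i)) p \<longleftrightarrow> i \<le> (j :: nat)"
proof -
  obtain E E' where E: "range E \<subseteq> ProdM" "e = cls \<circ> E" and E': "range E' \<subseteq> ProdM" "e' = cls \<circ> E'"
    using lift_assignment[OF e(1)] lift_assignment[OF e(2)] by metis
  obtain C D where C: "C \<in> ProdM" "c = cls C" and D: "D \<in> ProdM" "d = cls D"
    using c(1) d(1) by (auto simp: defset_def universe_R)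
  let ?S = "\<lambda>E i. defset (M i) p (\<lambda>v. E v i)"
  note iff = cls_in_defset_horn_iff[OF p]
  have good: "\<forall>\<^sub>F i in \<F>. C i \<in> ?S E i \<and> C i \<in> ?S E' i \<and> D i \<in> ?S E i"
    using c d(1) by (simp add: eventually_conj_iff E E' C D iff)
  have "\<exists>\<^sub>F i in \<F>. D i \<notin> ?S E' i"
    using d(2) by (simp add: E' D iff frequently_def)
  then have "\<forall>j\<in>UNIV. \<exists>\<^sub>F i in \<F>. D i \<notin> ?S E' i" by blast
  then obtain s :: "'i \<Rightarrow> nat" where s: "\<forall>j\<in>UNIV. \<exists>\<^sub>F i in \<F>. s i = j \<and> D i \<notin> ?S E' i"
    by (rule layered_colouring[OF layered countableI_type])
  define a where "a l = (\<lambda>i\<in>I. if s i < l then D i else C i)" for l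
  define b where "b j v = (\<lambda>i\<in>I. if s i = j then E' v i else E v i)" for j v
  have a: "a l \<in> ProdM" for l
    using PiE_mem[OF C(1)] PiE_mem[OF D(1)] by (simp add: a_def)
  have b: "range (b j) \<subseteq> ProdM" for j
    using range_component[OF E(1)] range_component[OF E'(1)] by (auto simp: b_def image_subset_iff)
  have b_S: "?S (b j) i = (if s i = j then ?S E' i else ?S E i)" if "i \<in> I" for i j
    using that by (simp add: b_def)
  have "(\<forall>\<^sub>F i in \<F>. a l i \<in> ?S (b j) i) \<longleftrightarrow> l \<le> j" for l j
  proof -
    have "\<forall>\<^sub>F i in \<F>. a l i \<in> ?S (b j) i \<longleftrightarrow> (s i = j \<and> j < l \<longrightarrow> D i \<in> ?S E' i)"
      using good eventually_mem by eventually_elim (auto simp: b_S a_def)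
    then have "(\<forall>\<^sub>F i in \<F>. a l i \<in> ?S (b j) i) \<longleftrightarrow> (\<forall>\<^sub>F i in \<F>. s i = j \<and> j < l \<longrightarrow> D i \<in> ?S E' i)"
      by (rule eventually_subst)
    also have "\<dots> \<longleftrightarrow> l \<le> j"
      using s[rule_format, of j] by (cases "l \<le> j") (simp_all add: frequently_def not_le)
    finally show ?thesis .
  qed
  then have "cls (a l) \<in> defset R p (cls \<circ> b j) \<longleftrightarrow> l \<le> j" for l j
    using iff[OF b a] by simp
  then have "sat R ((cls \<circ> b j)(0 := (cls \<circ> a) l)) p \<longleftrightarrow> l \<le> j" for l j
    using cls_in_universe[OF a] by (simp add: defset_def)
  moreover have "range (cls \<circ> a) \<subseteq> universe R" "range (cls \<circ> b j) \<subseteq> universe R" for j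
    by (rule range_cls, use a b in blast)+
  ultimately show thesis
    by (intro that[of "cls \<circ> a" "\<lambda>j. cls \<circ> b j"]) simp_all
qed

end


subsection \<open>Stable products\<close>

locale stable_layered_product = layered_product I J L M
  for I :: "'i set" and J :: "'i set set"
    and L :: "('f, 'r) language" and M :: "'i \<Rightarrow> ('f, 'r, 'a) struct" +
  assumes stable: "stable TYPE(('i \<Rightarrow> 'a) set) L (theory_of L R)"
begin

lemma horn_sets_subset_if_meet:
  assumes p: "horn p" and e: "range e \<subseteq> universe R" "range e' \<subseteq> universe R"
    and c: "c \<in> defset R p e" "c \<in> defset R p e'"
  shows "defset R p e \<subseteq> defset R p e'"
proof (rule subsetI, rule ccontr)
  fix d assume "d \<in> defset R p e" "d \<notin> defset R p e'"
  then obtain a b where ab: "range a \<subseteq> universe R" "\<forall>j. range (b j) \<subseteq> universe R"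
      "\<forall>i j. sat R ((b j)(0 := a i)) p \<longleftrightarrow> i \<le> (j :: nat)"
    by (rule horn_order_if_overlap[OF p e c]) (rule that)
  then show False
    using stable_theory_of_no_order[OF stable is_structure_R wf_fm_horn[OF p] ab(1,2)] ab(3) by blast
qed

lemma horn_sets_eq_if_meet:
  assumes "horn p" "range e \<subseteq> universe R" "range e' \<subseteq> universe R"
    and "c \<in> defset R p e" "c \<in> defset R p e'"
  shows "defset R p e = defset R p e'"
  using horn_sets_subset_if_meet assms by (metis subset_antisym)

lemma ultra_unlinked_pair:
  assumes p: "horn p" and G: "ultra_on (universe R) G" "defsets R {p} (universe R) \<inter> G = {}"
    and S: "S \<in> G"
  shows "\<exists>c \<in> universe R \<inter> S. \<exists>d \<in> universe R \<inter> S. \<not> linked R p c d"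
proof -
  obtain c where c: "c \<in> universe R" "c \<in> S"
    using ultra_on_nonempty[OF G(1), of "{S}"] S by auto
  show ?thesis
  proof (cases "\<exists>e. range e \<subseteq> universe R \<and> c \<in> defset R p e")
    case True
    then obtain e where e: "range e \<subseteq> universe R" "c \<in> defset R p e" by blast
    then have "defset R p e \<notin> G"
      using G(2) unfolding defsets_def by blast
    then obtain d where d: "d \<in> universe R" "d \<in> S" "d \<notin> defset R p e"
      using ultra_on_finite_approx[OF G(1), of "{S, defset R p e}"] S by auto
    then have "\<not> linked R p c d"
      using horn_sets_eq_if_meet[OF p e(1)] e(2) unfolding linked_def by metis
    with c d show ?thesis by blast
  next
    case False
    then have "\<not> linked R p c c"
      unfolding linked_def by blast
    with c show ?thesis by blast
  qed
qed

lemma countable_horn: "countable_language L \<Longrightarrow> countable (Collect horn)"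
  by (rule countable_subset[OF _ countable_wf_fm]) (auto simp: wf_fm_horn)

lemma countable_ultra_horn_sets:
  assumes L: "countable_language L" and G: "ultra_on (universe R) G"
  shows "countable (G \<inter> horn_sets (universe R))" (is "countable ?\<X>")
proof -
  have "\<forall>S\<in>?\<X>. \<exists>p. horn p \<and> S \<in> defsets R {p} (universe R)"
    unfolding defsets_def by blast
  then obtain p where p: "\<And>S. S \<in> ?\<X> \<Longrightarrow> horn (p S) \<and> S \<in> defsets R {p S} (universe R)"
    by metis
  have "inj_on p ?\<X>"
  proof (rule inj_onI)
    fix S T assume S: "S \<in> ?\<X>" and T: "T \<in> ?\<X>" and eq: "p S = p T"
    obtain e e' where "range e \<subseteq> universe R" "S = defset R (p T) e"
        "range e' \<subseteq> universe R" "T = defset R (p T) e'"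
      using p[OF S] p[OF T] eq unfolding defsets_def by auto
    moreover obtain c where "c \<in> S" "c \<in> T"
      using ultra_on_nonempty[OF G, of "{S, T}"] S T by auto
    ultimately show "S = T"
      using p[OF T] horn_sets_eq_if_meet[of "p T" e e' c] by simp
  qed
  moreover have "countable (p ` ?\<X>)"
    by (rule countable_subset[OF _ countable_horn[OF L]]) (use p in blast)
  ultimately show ?thesis
    by (rule countable_image_inj_on[rotated])
qed

lemma horn_type_candidates:
  assumes L: "countable_language L" and G: "ultra_on (universe R) G"
  obtains c :: "nat set \<Rightarrow> ('i \<Rightarrow> 'a) set" where "\<And>f. c f \<in> universe R"
    "\<And>f S. S \<in> G \<inter> horn_sets (universe R) \<Longrightarrow> c f \<in> S"
    "\<And>f g p. f \<noteq> g \<Longrightarrow> horn p \<Longrightarrow> defsets R {p} (universe R) \<inter> G = {} \<Longrightarrow> \<not> linked R p (c f) (c g)"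
proof -
  let ?\<X> = "G \<inter> horn_sets (universe R)"
  let ?N = "{p. horn p \<and> defsets R {p} (universe R) \<inter> G = {}}"
  obtain c :: "nat set \<Rightarrow> ('i \<Rightarrow> 'a) set" where c: "\<And>f. c f \<in> universe R" "\<And>f S. S \<in> ?\<X> \<Longrightarrow> c f \<in> S"
    and c_unlinked: "\<And>f g p. f \<noteq> g \<Longrightarrow> p \<in> ?N \<Longrightarrow> \<not> linked R p (c f) (c g)"
  proof (rule horn_sets_continuum_unlinked[of ?\<X> ?N])
    show "countable ?\<X>"
      by (rule countable_ultra_horn_sets[OF L G])
    have "universe R \<in> G" "universe R \<noteq> {}"
      using ultra_on_finite_approx[OF G, of "{universe R}"] by auto
    then show "?\<X> \<noteq> {}"
      using universe_in_horn_sets by blast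
    show "countable ?N"
      by (rule countable_subset[OF _ countable_horn[OF L]]) auto
    show "universe R \<inter> \<Inter>Q \<noteq> {}" if "finite Q" "Q \<subseteq> ?\<X>" for Q
      using ultra_on_nonempty[OF G] that by blast
    show "\<exists>c \<in> universe R \<inter> \<Inter>Q. \<exists>d \<in> universe R \<inter> \<Inter>Q. \<not> linked R p c d"
      if "finite Q" "Q \<subseteq> ?\<X>" "p \<in> ?N" for Q p
      using that by (intro ultra_unlinked_pair[OF _ G] ultra_on_Inter[OF G]) auto
  qed (auto intro: that)
  show thesis
    using c c_unlinked by (intro that[of c]) auto
qed

lemma horn_type_candidates_separated:
  assumes L: "countable_language L" and G: "ultra_on (universe R) G"
  obtains c :: "nat set \<Rightarrow> ('i \<Rightarrow> 'a) set" where "\<And>f. c f \<in> universe R"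
    "\<And>f S. S \<in> horn_sets (universe R) \<Longrightarrow> S \<in> G \<Longrightarrow> c f \<in> S"
    "\<And>f g S. S \<in> horn_sets (universe R) \<Longrightarrow> S \<notin> G \<Longrightarrow> c f \<in> S \<Longrightarrow> c g \<in> S \<Longrightarrow> f = g"
proof -
  obtain c :: "nat set \<Rightarrow> ('i \<Rightarrow> 'a) set" where c: "\<And>f. c f \<in> universe R"
      "\<And>f S. S \<in> G \<inter> horn_sets (universe R) \<Longrightarrow> c f \<in> S"
    and c_unlinked: "\<And>f g p. f \<noteq> g \<Longrightarrow> horn p \<Longrightarrow> defsets R {p} (universe R) \<inter> G = {} \<Longrightarrow>
      \<not> linked R p (c f) (c g)"
    by (rule horn_type_candidates[OF L G]) (rule that)
  have "f = g" if S: "S \<in> horn_sets (universe R)" "S \<notin> G" and fg: "c f \<in> S" "c g \<in> S" for S f g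
  proof -
    obtain p e where p: "horn p" and e: "range e \<subseteq> universe R" "S = defset R p e"
      using S(1) unfolding defsets_def by blast
    have "defset R p e' \<notin> G" if e': "range e' \<subseteq> universe R" for e'
    proof
      assume G': "defset R p e' \<in> G"
      then have "c f \<in> defset R p e'"
        using p e' by (intro c(2) IntI defsetsI) simp_all
      then have "S = defset R p e'"
        using horn_sets_eq_if_meet[OF p e(1) e'] fg(1) e(2) by blast
      with G' S(2) show False by blast
    qed
    then have "defsets R {p} (universe R) \<inter> G = {}"
      unfolding defsets_def by blast
    moreover have "linked R p (c f) (c g)"
      using e fg by (intro linkedI) auto
    ultimately show "f = g"
      using c_unlinked p by blast
  qed
  with c show thesis
    by (intro that[of c]) auto
qed

lemma horn_type_realised:
  assumes L: "countable_language L" and G: "ultra_on (universe R) G"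
    and A: "A \<subseteq> universe R" "A \<noteq> {}" "A \<prec> continuum"
  shows "\<exists>c\<in>universe R. \<forall>S \<in> horn_sets A. c \<in> S \<longleftrightarrow> S \<in> G"
proof -
  obtain c :: "nat set \<Rightarrow> ('i \<Rightarrow> 'a) set" where c: "\<And>f. c f \<in> universe R"
      "\<And>f S. S \<in> horn_sets (universe R) \<Longrightarrow> S \<in> G \<Longrightarrow> c f \<in> S"
      "\<And>f g S. S \<in> horn_sets (universe R) \<Longrightarrow> S \<notin> G \<Longrightarrow> c f \<in> S \<Longrightarrow> c g \<in> S \<Longrightarrow> f = g"
    by (rule horn_type_candidates_separated[OF L G]) (rule that)
  have horn_sets_A: "horn_sets A \<subseteq> horn_sets (universe R)"
    using A(1) unfolding defsets_def by blast
  have "horn_sets A - G \<lesssim> horn_sets A"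
    by (rule subset_imp_lepoll) blast
  also have "\<dots> \<lesssim> Collect horn \<times> lists A"
    by (rule defsets_lepoll[OF A(2)])
  also have "\<dots> \<prec> continuum"
    using countable_horn[OF L] nat_lesspoll_continuum A(3) by (rule countable_times_lists_lesspoll)
  finally obtain f where f: "\<And>S. S \<in> horn_sets A - G \<Longrightarrow> c f \<notin> S"
    by (rule lesspoll_avoid[where R = "\<lambda>f S. c f \<in> S"]) (use c(3) horn_sets_A in blast)+
  have "c f \<in> S \<longleftrightarrow> S \<in> G" if "S \<in> horn_sets A" for S
    using that c(2)[of S f] f[of S] horn_sets_A by blast
  with c(1) show ?thesis by blast
qed

lemma card_saturated_continuum:
  assumes "countable_language L"
  shows "card_saturated L continuum R"
proof (rule card_saturated_if_ultra_realised)
  show "infinite continuum"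
    using nat_lesspoll_continuum by (simp add: infinite_le_lepoll lesspoll_imp_lepoll)
  fix A G assume A: "A \<subseteq> universe R" "A \<noteq> {}" "A \<prec> continuum" and G: "ultra_on (universe R) G"
  then obtain c where c: "c \<in> universe R"
    and horn: "\<And>S. S \<in> horn_sets A \<Longrightarrow> c \<in> S \<longleftrightarrow> S \<in> G"
    using horn_type_realised[OF assms G A] by blast
  have "c \<in> defset R p e \<longleftrightarrow> defset R p e \<in> G" if p: "wf_fm L p" and e: "range e \<subseteq> A" for p e
  proof (rule ultra_determined_by_horn[OF G p c])
    show "range e \<subseteq> universe R"
      using e A(1) by (rule subset_trans)
    show "c \<in> defset R q e \<longleftrightarrow> defset R q e \<in> G" if "horn q" for q
      using that e by (intro horn defsetsI) simp_all
  qed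
  with c show "\<exists>c\<in>universe R. \<forall>S \<in> defsets R {p. wf_fm L p} A. S \<in> G \<longrightarrow> c \<in> S"
    unfolding defsets_def by blast
qed

end

lemma (in ideal_product) saturated_if_small:
  assumes "card_saturated L continuum R"
    and "Pow I \<lesssim> continuum" "\<forall>i\<in>I. universe (M i) \<lesssim> continuum"
  shows "saturated L R"
proof -
  have "universe R \<lesssim> ProdM"
    unfolding universe_R by (rule image_lepoll)
  also have "ProdM \<lesssim> continuum"
    using assms(2,3) by (intro PiE_lepoll_continuum) auto
  finally have "A \<prec> continuum" if "A \<prec> universe R" for A :: "('i \<Rightarrow> 'a) set set"
    using that lesspoll_trans2 by blast
  then show ?thesis
    using assms(1) unfolding saturated_def card_saturated_def by blast
qed

theorem theorem5p2:
  fixes I :: "'i set" and J :: "'i set set"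
    and L :: "('f, 'r) language" and M :: "'i \<Rightarrow> ('f, 'r, 'a) struct"
  assumes "layered I J"
    and "countable_language L"
    and "\<forall>i\<in>I. is_structure L (M i)"
    and "stable TYPE(('i \<Rightarrow> 'a) set) L (theory_of L (reduced_product I J M))"
  shows "card_saturated L continuum (reduced_product I J M) \<and>
    (Pow I \<lesssim> continuum \<and> (\<forall>i\<in>I. universe (M i) \<lesssim> continuum) \<longrightarrow>
      saturated L (reduced_product I J M))"
proof -
  interpret stable_layered_product I J L M
    using assms by unfold_locales (rule layered_ideal)
  show ?thesis
    using card_saturated_continuum[OF assms(2)] saturated_if_small by blast
qed

end
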